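(* Let $(W,H,\mu)$ be an abstract Wiener space. Assume that $Z:W\to W$ is a measurable map such that $Z\mu\ll\mu$ and $d_H(Z\mu,\mu)<\infty$. Then $Z$ can be decomposed as $$Z=T\circ s\qquad\mu\text{-almost surely},$$ where $T$ is the unique transport map of the Monge–Kantorovitch problem for $\Sigma(\mu,Z\mu)$ and $s:W\to W$ is a rotation, i.e. $s\mu=\mu$.
   Context: Abstract Wiener space: $W$ is a separable Fréchet space, $H$ (Cameron–Martin space) a separable Hilbert space densely and continuously embedded in $W$, $W^*\hookrightarrow H^*=H\hookrightarrow W$, and $\mu$ is the probability on $\mathcal B(W)$ such that each $e\in W^*$ has law $N(0,|e|_H^2)$ under $\mu$. $Z\mu$ is the image of $\mu$ under $Z$. $\Sigma(\xi,\eta)$ is the set of probability measures on $W\times W$ with marginals $\xi$ and $\eta$, and $d_H^2(\xi,\eta)=\inf\{\int_{W\times W}|x-y|_H^2\,d\beta(x,y):\beta\in\Sigma(\xi,\eta)\}$, where $|x-y|_H=\infty$ if $x-y\notin H$; the Monge–Kantorovitch problem asks for a minimizing $\beta$. Transport map (known fact used to define $T$): if $\nu\ll\mu$ is a probability with $d_H(\mu,\nu)<\infty$, the Monge–Kantorovitch problem for $\Sigma(\mu,\nu)$ has a unique solution $\gamma$, and $\gamma=(I_W\times T)\mu$ where $T=I_W+\nabla\phi$ with $\phi\in\mathbb D_{2,1}$ (the Gaussian Sobolev space of $L^2(\mu)$ functions with $L^2(\mu,H)$ Malliavin gradient $\nabla\phi$) 1-convex, i.e. $h\mapsto\phi(x+h)+\frac12|h|_H^2$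 is convex on $H$ with values in $L^0(\mu)$; $T$ is $\mu$-a.s. unique. *)

theory Defs
  imports "HOL-Probability.Probability"
begin

section \<open>Separable Frechet spaces\<close>

definition (in real_vector) seminorm :: "('a \<Rightarrow> real) \<Rightarrow> bool" where
  "seminorm p \<longleftrightarrow>
     (\<forall>x y. p (x + y) \<le> p x + p y) \<and> (\<forall>c x. p (c *\<^sub>R x) = \<bar>c\<bar> * p x)"

text \<open>
  The topology is the one generated by a countable separating family of seminorms, and the space is
  (sequentially) complete.  Separability is expressed by the additional sort
  \<^class>\<open>second_countable_topology\<close>, which is equivalent for such (metrizable) spaces.
\<close>

class frechet_space = real_vector + topological_space +
  assumes frechet_seminorms:
    "\<exists>p::nat \<Rightarrow> 'a \<Rightarrow> real.
       (\<forall>n. seminorm (p n)) \<and>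
       (\<forall>x. (\<forall>n. p n x = 0) \<longrightarrow> x = 0) \<and>
       (\<forall>U. open U \<longleftrightarrow> (\<forall>x\<in>U. \<exists>n. \<exists>\<epsilon>>0. {y. \<forall>i\<le>n. p i (y - x) < \<epsilon>} \<subseteq> U)) \<and>
       (\<forall>X::nat \<Rightarrow> 'a.
          (\<forall>n. \<forall>\<epsilon>>0. \<exists>N. \<forall>k\<ge>N. \<forall>l\<ge>N. p n (X k - X l) < \<epsilon>) \<longrightarrow>
          (\<exists>L. \<forall>n. (\<lambda>k. p n (X k - L)) \<longlonglongrightarrow> 0))"


section \<open>Abstract Wiener spaces\<close>

text \<open>
  The Cameron--Martin space is a type \<open>'h\<close> with an explicit embedding \<open>j\<close> into \<open>W\<close>.
\<close>

definition topological_dual :: "('w::{real_vector, topological_space} \<Rightarrow> real) set" where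
  "topological_dual = {e. linear e \<and> continuous_on UNIV e}"

text \<open>
  The injection of the dual of \<open>W\<close> into \<open>H\<close>: restrict \<open>e\<close> to \<open>H\<close> and identify the dual of \<open>H\<close>
  with \<open>H\<close>; existence and uniqueness of the vector are the Riesz representation theorem.
\<close>

definition riesz_vec :: "('h::real_inner \<Rightarrow> 'w) \<Rightarrow> ('w \<Rightarrow> real) \<Rightarrow> 'h" where
  "riesz_vec j e = (THE h. \<forall>k. e (j k) = inner h k)"

text \<open>The law \<open>N(0, \<sigma>\<^sup>2)\<close>, degenerate for \<open>\<sigma> = 0\<close>.\<close>

definition gaussian_law :: "real \<Rightarrow> real measure" where
  "gaussian_law \<sigma> =
     (if \<sigma> = 0 then return borel 0 else density lborel (\<lambda>t. ennreal (normal_density 0 \<sigma> t)))"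

locale abstract_wiener_space =
  fixes j :: "'h::{real_inner, polish_space} \<Rightarrow> 'w::{frechet_space, second_countable_topology}"
    and \<mu> :: "'w measure"
  assumes linear_j: "linear j"
    and inj_j: "inj j"
    and continuous_j: "continuous_on UNIV j"
    and dense_j: "closure (range j) = UNIV"
    and sets_\<mu>: "sets \<mu> = sets borel"
    and prob_\<mu>: "prob_space \<mu>"
    and gaussian_\<mu>: "\<And>e. e \<in> topological_dual \<Longrightarrow>
      distr \<mu> borel e = gaussian_law (norm (riesz_vec j e))"


section \<open>The Monge--Kantorovitch problem\<close>

definition couplings ::
  "'w::topological_space measure \<Rightarrow> 'w measure \<Rightarrow> ('w \<times> 'w) measure set" where
  "couplings \<xi> \<eta> = {\<beta>. sets \<beta> = sets (borel \<Otimes>\<^sub>M borel) \<and> prob_space \<beta> \<and>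
     distr \<beta> borel fst = \<xi> \<and> distr \<beta> borel snd = \<eta>}"

definition cm_norm_sq :: "('h::real_inner \<Rightarrow> 'w) \<Rightarrow> 'w \<Rightarrow> ennreal" where
  "cm_norm_sq j w = (if w \<in> range j then ennreal ((norm (inv j w))\<^sup>2) else \<infinity>)"

definition transport_cost ::
  "('h::real_inner \<Rightarrow> 'w::real_vector) \<Rightarrow> ('w \<times> 'w) measure \<Rightarrow> ennreal" where
  "transport_cost j \<beta> = (\<integral>\<^sup>+ (x, y). cm_norm_sq j (x - y) \<partial>\<beta>)"

text \<open>The square of \<open>d\<^sub>H\<close>.\<close>

definition dH_sq ::
  "('h::real_inner \<Rightarrow> 'w::{real_vector, topological_space}) \<Rightarrow> 'w measure \<Rightarrow> 'w measure \<Rightarrow> ennreal"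
  where "dH_sq j \<xi> \<eta> = (INF \<beta>\<in>couplings \<xi> \<eta>. transport_cost j \<beta>)"

definition mk_solution ::
  "('h::real_inner \<Rightarrow> 'w::{real_vector, topological_space}) \<Rightarrow> 'w measure \<Rightarrow> 'w measure \<Rightarrow>
   ('w \<times> 'w) measure \<Rightarrow> bool" where
  "mk_solution j \<xi> \<eta> \<beta> \<longleftrightarrow>
     \<beta> \<in> couplings \<xi> \<eta> \<and> (\<forall>\<beta>'\<in>couplings \<xi> \<eta>. transport_cost j \<beta> \<le> transport_cost j \<beta>')"


section \<open>The Gaussian Sobolev space and 1-convexity\<close>

text \<open>
  A bounded smooth function on \<open>\<real>\<^sup>n\<close> with all its derivatives bounded, where \<open>n\<close> is a term: a
  function on \<open>nat \<Rightarrow> real\<close> depending only on the coordinates below \<open>n\<close>.  It is represented by the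
  family of its iterated partial derivatives, indexed by lists of coordinates; the function itself
  is \<open>D []\<close>.
\<close>

definition smooth_bounded :: "nat \<Rightarrow> (nat list \<Rightarrow> (nat \<Rightarrow> real) \<Rightarrow> real) \<Rightarrow> bool" where
  "smooth_bounded n D \<longleftrightarrow>
     (\<forall>\<alpha>. set \<alpha> \<subseteq> {..<n} \<longrightarrow>
        continuous_on UNIV (D \<alpha>) \<and> bounded (range (D \<alpha>)) \<and>
        (\<forall>x y. (\<forall>i<n. x i = y i) \<longrightarrow> D \<alpha> x = D \<alpha> y) \<and>
        (\<forall>i<n. \<forall>x. ((\<lambda>t. D \<alpha> (x(i := t))) has_real_derivative D (i # \<alpha>) x) (at (x i))))"

text \<open>
  \<open>F = f(e\<^sub>0, \<dots>, e\<^bsub>n-1\<^esub>)\<close> is a smooth cylindrical function with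
  gradient \<open>G = \<Sum>\<^sub>i \<partial>\<^sub>i f(e\<^sub>0, \<dots>, e\<^bsub>n-1\<^esub>) e\<^sub>i\<close>.
\<close>

definition cylindrical_gradient ::
  "('h::real_inner \<Rightarrow> 'w::{real_vector, topological_space}) \<Rightarrow> ('w \<Rightarrow> real) \<Rightarrow> ('w \<Rightarrow> 'h) \<Rightarrow> bool"
  where
  "cylindrical_gradient j F G \<longleftrightarrow>
     (\<exists>n D e. smooth_bounded n D \<and> (\<forall>i<n. e i \<in> topological_dual) \<and>
        F = (\<lambda>x. D [] (\<lambda>i. e i x)) \<and>
        G = (\<lambda>x. \<Sum>i<n. D [i] (\<lambda>i. e i x) *\<^sub>R riesz_vec j (e i)))"

text \<open>
  \<open>\<phi>\<close> belongs to \<open>D\<^bsub>2,1\<^esub>\<close> and \<open>G\<close> is (a version of) its Malliavin gradient: the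
  closure of the gradient on smooth cylindrical functions, from \<open>L\<^sup>2(\<mu>)\<close> to \<open>L\<^sup>2(\<mu>, H)\<close>.
  Square integrability of \<open>\<phi>\<close> and \<open>G\<close> is implied, as they are \<open>L\<^sup>2\<close>-limits of bounded functions.
\<close>

definition malliavin_gradient ::
  "('h::real_inner \<Rightarrow> 'w::{real_vector, topological_space}) \<Rightarrow> 'w measure \<Rightarrow>
   ('w \<Rightarrow> real) \<Rightarrow> ('w \<Rightarrow> 'h) \<Rightarrow> bool" where
  "malliavin_gradient j \<mu> \<phi> G \<longleftrightarrow>
     \<phi> \<in> borel_measurable \<mu> \<and> G \<in> borel_measurable \<mu> \<and>
     (\<exists>Fs Gs. (\<forall>k::nat. cylindrical_gradient j (Fs k) (Gs k)) \<and>
        (\<lambda>k. \<integral>\<^sup>+ x. ennreal ((Fs k x - \<phi> x)\<^sup>2) \<partial>\<mu>) \<longlonglongrightarrow> 0 \<and>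
        (\<lambda>k. \<integral>\<^sup>+ x. ennreal ((norm (Gs k x - G x))\<^sup>2) \<partial>\<mu>) \<longlonglongrightarrow> 0)"

text \<open>
  Convexity of \<open>h \<mapsto> \<phi>(x + h) + \<bar>h\<bar>\<^sup>2/2\<close> as a map from \<open>H\<close> to \<open>L\<^sup>0(\<mu>)\<close>: the exceptional null
  set may depend on \<open>h\<close>, \<open>k\<close> and \<open>t\<close>.
\<close>

definition one_convex ::
  "('h::real_inner \<Rightarrow> 'w::real_vector) \<Rightarrow> 'w measure \<Rightarrow> ('w \<Rightarrow> real) \<Rightarrow> bool" where
  "one_convex j \<mu> \<phi> \<longleftrightarrow>
     (\<forall>h k. \<forall>t\<in>{0..1}. AE x in \<mu>.
        \<phi> (x + j ((1 - t) *\<^sub>R h + t *\<^sub>R k)) + (norm ((1 - t) *\<^sub>R h + t *\<^sub>R k))\<^sup>2 / 2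
        \<le> (1 - t) * (\<phi> (x + j h) + (norm h)\<^sup>2 / 2) + t * (\<phi> (x + j k) + (norm k)\<^sup>2 / 2))"


section \<open>Transport maps\<close>

text \<open>
  The transport map for \<open>\<Sigma>(\<mu>, \<nu>)\<close>.  That it exists and is \<open>\<mu>\<close>-almost surely unique for
  \<open>\<nu> \<lless> \<mu>\<close> at finite distance is the theorem of Feyel and Ustunel, and is not built into the
  definition.
\<close>

definition transport_map ::
  "('h::real_inner \<Rightarrow> 'w::{real_vector, topological_space}) \<Rightarrow> 'w measure \<Rightarrow> 'w measure \<Rightarrow>
   ('w \<Rightarrow> 'w) \<Rightarrow> bool" where
  "transport_map j \<mu> \<nu> T \<longleftrightarrow>
     T \<in> borel_measurable borel \<and>
     mk_solution j \<mu> \<nu> (distr \<mu> (borel \<Otimes>\<^sub>M borel) (\<lambda>x. (x, T x))) \<and>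
     (\<exists>\<phi> G. malliavin_gradient j \<mu> \<phi> G \<and> one_convex j \<mu> \<phi> \<and> (AE x in \<mu>. T x = x + j (G x)))"

end

theory Submission
  imports Defs
begin

text \<open>
  The point is that the optimal map \<open>T\<close> is essentially injective: there is a Borel map \<open>S\<close> with
  \<open>S \<circ> T = id\<close> almost surely, and then \<open>s = S \<circ> Z\<close> is the required rotation, because \<open>T\<close> and \<open>Z\<close>
  have the same law.

  Let \<open>e \<in> W\<^sup>*\<close> have a unit vector \<open>k \<in> H\<close> as its image, and suppose that the images under \<open>T\<close> of
  the restrictions of \<open>\<mu>\<close> to \<open>{x. e (x - T x) < a}\<close> and to \<open>{x. e (x - T x) > b}\<close>, where \<open>a < b\<close>,
  are not mutually singular.  Both are absolutely continuous with respect to \<open>\<mu>\<close>, whose null sets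
  are invariant under translations by \<open>t k\<close>; so for some \<open>0 < t < b - a\<close> the second image and
  the translate by \<open>-t k\<close> of the first one have a common part.  Exchanging the targets \<open>y\<close> and
  \<open>y + t k\<close> of the corresponding masses preserves the marginals and strictly decreases the
  cost, a contradiction.  Hence \<open>e (x - T x)\<close>, and therefore \<open>e x\<close>, is almost surely a function of \<open>T x\<close>;
  countably many \<open>e\<close> determine \<open>x\<close>.
\<close>

section \<open>Hilbert spaces\<close>

text \<open>Two points with the same target gain nothing by exchanging it, so a failure of
  injectivity does not contradict optimality directly. The shift by t k makes the exchange
  effective: with x - T x = h, the squared norm changes by 2 t (k, h) + t^2 when the target moves to
  T x - t k and by - 2 t (k, h) + t^2 when it moves to T x + t k. As (k, h) < a in the first case
  and (k, h) > b in the second, equal masses give a change of at most 2 t (t - (b - a)) per unit,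
  which is where t < b - a comes from. The images must still overlap after the shift, and here the
  Gaussian measure enters: replacing \<open>e x\<close> by an independent standard normal variable
  preserves \<mu>, and on lines in direction k a normal law has the null sets of Lebesgue measure.
  The functional analysis brings the space down to functionals. By Hahn-Banach, countably many of
  them norm the defining seminorms, so that Borel sets and the reconstruction of x can be read off
  from them; a form of weak compactness of the balls of H makes the cost measurable.\<close>

text \<open>Stands in for weak compactness of bounded closed convex sets. Points of nearly minimal
  norm in \<open>C n\<close> form a Cauchy sequence by the parallelogram law, and their limit lies
  in every \<open>C n\<close>.\<close>

lemma nested_closed_convex_Inter_nonempty:
  fixes C :: "nat \<Rightarrow> 'h::{real_inner, complete_space} set"
  assumes closed: "\<And>n. closed (C n)" and convex: "\<And>n. convex (C n)"
    and ne: "\<And>n. C n \<noteq> {}" and dec: "decseq C" and bdd: "bounded (C 0)"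
  shows "\<exists>x. \<forall>n. x \<in> C n"
proof -
  obtain r where r: "\<And>x. x \<in> C 0 \<Longrightarrow> norm x \<le> r"
    using bdd by (auto simp: bounded_iff)
  have sub: "C m \<subseteq> C n" if "n \<le> m" for n m using dec that by (auto simp: decseq_def)
  define d where "d n = (INF x\<in>C n. norm x)" for n
  have bb: "bdd_below (norm ` C n)" for n by (intro bdd_belowI[of _ 0]) auto
  have d_le: "d n \<le> norm x" if "x \<in> C n" for n x
    unfolding d_def using bb that by (intro cINF_lower)
  have d0: "0 \<le> d n" for n unfolding d_def using ne by (intro cINF_greatest) auto
  have "incseq d" unfolding d_def
    by (intro incseq_SucI cINF_superset_mono) (use ne bb sub in auto)
  moreover have dr: "d n \<le> r" for n
  proof -
    obtain x where "x \<in> C n" using ne by blast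
    then show ?thesis using d_le r sub[of 0 n] by force
  qed
  ultimately obtain l where l: "d \<longlonglongrightarrow> l" "\<And>n. d n \<le> l"
    using incseq_convergent[of d r] by blast
  have "\<exists>x\<in>C n. norm x < d n + 1 / (real n + 1)" for n
    using cINF_less_iff[OF ne bb, of n "d n + 1 / (real n + 1)"] by (auto simp: d_def)
  then obtain g where g: "\<And>n. g n \<in> C n" "\<And>n. norm (g n) < d n + 1 / (real n + 1)"
    by metis
  \<comment> \<open>For m >= n the norms of \<open>g n\<close> and \<open>g m\<close> are bounded by
    the two squared terms, and their midpoint lies in \<open>C n\<close>, hence has norm at least
    \<open>d n\<close>. As d tends to l, the bound tends to 4 l^2 - 4 l^2 = 0.\<close>
  define b where "b n = 2 * (d n + 1 / (real n + 1))\<^sup>2 + 2 * (l + 1 / (real n + 1))\<^sup>2 - 4 * (d n)\<^sup>2" for n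
  have dist_le: "(dist (g n) (g m))\<^sup>2 \<le> b n" if "n \<le> m" for n m
  proof -
    have "(1/2) *\<^sub>R g n + (1/2) *\<^sub>R g m \<in> C n"
      using convex[of n] g(1)[of n] g(1)[of m] sub[OF that] unfolding convex_def by force
    then have "(d n)\<^sup>2 \<le> (norm ((1/2) *\<^sub>R g n + (1/2) *\<^sub>R g m))\<^sup>2"
      using d_le d0 by (intro power_mono)
    moreover have "(norm (g n))\<^sup>2 \<le> (d n + 1 / (real n + 1))\<^sup>2"
      using g(2)[of n] by (intro power_mono) auto
    moreover have "(norm (g m))\<^sup>2 \<le> (l + 1 / (real n + 1))\<^sup>2"
    proof -
      have "1 / (real m + 1) \<le> 1 / (real n + 1)" using that by (simp add: frac_le)
      then have "norm (g m) \<le> l + 1 / (real n + 1)" using g(2)[of m] l(2)[of m] by linarith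
      then show ?thesis by (intro power_mono) auto
    qed
    moreover have "(dist (g n) (g m))\<^sup>2 = 2 * (norm (g n))\<^sup>2 + 2 * (norm (g m))\<^sup>2
        - 4 * (norm ((1/2) *\<^sub>R g n + (1/2) *\<^sub>R g m))\<^sup>2"
      unfolding dist_norm power2_norm_eq_inner
      by (simp add: inner_add_left inner_add_right inner_diff_left inner_diff_right inner_commute)
    ultimately show ?thesis unfolding b_def by linarith
  qed
  have "b \<longlonglongrightarrow> 2 * (l + 0)\<^sup>2 + 2 * (l + 0)\<^sup>2 - 4 * l\<^sup>2"
    unfolding b_def using l(1) LIMSEQ_Suc[OF lim_1_over_n]
    by (intro tendsto_intros) (auto simp: add.commute)
  then have b0: "b \<longlonglongrightarrow> 0" by simp
  have "Cauchy g"
  proof (rule CauchyI')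
    fix \<epsilon> :: real assume "0 < \<epsilon>"
    then obtain M where M: "\<And>n. n \<ge> M \<Longrightarrow> b n < \<epsilon>\<^sup>2"
      using order_tendstoD(2)[OF b0, of "\<epsilon>\<^sup>2"] by (auto simp: eventually_sequentially)
    show "\<exists>M. \<forall>m\<ge>M. \<forall>n>m. dist (g m) (g n) < \<epsilon>"
    proof (intro exI[of _ M] allI impI)
      fix m n assume "M \<le> m" "m < n"
      then have "(dist (g m) (g n))\<^sup>2 < \<epsilon>\<^sup>2" using dist_le[of m n] M[of m] by linarith
      then show "dist (g m) (g n) < \<epsilon>" using \<open>0 < \<epsilon>\<close>
        by (simp add: power2_less_imp_less)
    qed
  qed
  then obtain x where x: "g \<longlonglongrightarrow> x" using Cauchy_convergent_iff convergent_def by blast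
  have "x \<in> C n" for n
  proof (rule Lim_in_closed_set[OF closed _ _ x])
    show "\<forall>\<^sub>F m in sequentially. g m \<in> C n"
      using g(1) sub by (auto intro!: eventually_sequentiallyI[of n])
  qed simp
  then show ?thesis by blast
qed

text \<open>The point g of least norm in the hyperplane f = 1 is orthogonal to the kernel of f, and
  k - f k g lies in that kernel; so f is a multiple of the inner product with g.\<close>

lemma riesz_representation:
  fixes f :: "'h::{real_inner, complete_space} \<Rightarrow> real"
  assumes lin: "linear f" and cont: "continuous_on UNIV f"
  shows "\<exists>h. \<forall>k. f k = inner h k"
proof (cases "\<forall>k. f k = 0")
  case True
  then show ?thesis by (intro exI[of _ 0]) simp
next
  case False
  note [simp] = linear_add[OF lin] linear_diff[OF lin] linear_scale[OF lin] linear_0[OF lin]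
  define C where "C = {x. f x = 1}"
  obtain k0 where "f k0 \<noteq> 0" using False by blast
  then have "(1 / f k0) *\<^sub>R k0 \<in> C" by (simp add: C_def)
  then have ne: "C \<noteq> {}" by blast
  have clC: "closed C" unfolding C_def
    using continuous_closed_vimage[of "{1}" f] cont
    by (simp add: continuous_on_eq_continuous_at vimage_def)
  have cvC: "convex C" unfolding C_def convex_def by simp
  define d where "d = (INF x\<in>C. norm x)"
  have bb: "bdd_below (norm ` C)" by (intro bdd_belowI[of _ 0]) auto
  have d_le: "d \<le> norm x" if "x \<in> C" for x
    unfolding d_def using bb that by (intro cINF_lower)
  have "\<exists>g. \<forall>n. g \<in> C \<inter> cball 0 (d + 1 / (real n + 1))"
  proof (intro nested_closed_convex_Inter_nonempty)
    fix n :: nat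
    have "\<exists>x\<in>C. norm x < d + 1 / (real n + 1)"
      using cINF_less_iff[OF ne bb, of "d + 1 / (real n + 1)"] by (auto simp: d_def)
    then show "C \<inter> cball 0 (d + 1 / (real n + 1)) \<noteq> {}" by fastforce
  next
    show "decseq (\<lambda>n. C \<inter> cball 0 (d + 1 / (real n + 1)))"
      unfolding decseq_def
    proof (intro allI impI subsetI)
      fix m n :: nat and x
      assume "m \<le> n" and x: "x \<in> C \<inter> cball 0 (d + 1 / (real n + 1))"
      then have "1 / (real n + 1) \<le> 1 / (real m + 1)" by (simp add: frac_le)
      then show "x \<in> C \<inter> cball 0 (d + 1 / (real m + 1))" using x by auto
    qed
  qed (auto intro!: closed_Int convex_Int clC cvC intro: bounded_subset[OF bounded_cball])
  then obtain g where g: "g \<in> C" "\<And>n. norm g \<le> d + 1 / (real n + 1)" by auto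
  have "(\<lambda>n. d + 1 / (real n + 1)) \<longlonglongrightarrow> d + 0"
    using LIMSEQ_Suc[OF lim_1_over_n] by (intro tendsto_intros) (auto simp: add.commute)
  then have gd: "norm g \<le> d" using g(2) by (intro LIMSEQ_le_const[of _ d]) auto
  have orth: "inner g k = 0" if "f k = 0" for k
  proof (cases "k = 0")
    case k: False
    \<comment> \<open>The minimizer of the quadratic function t -> |g + t k|^2.\<close>
    define t where "t = - inner g k / inner k k"
    have "norm g \<le> norm (g + t *\<^sub>R k)"
      using g(1) that gd d_le[of "g + t *\<^sub>R k"] by (auto simp: C_def)
    then have "inner g g \<le> inner (g + t *\<^sub>R k) (g + t *\<^sub>R k)" by (simp add: norm_le)
    also have "\<dots> = inner g g + 2 * t * inner g k + t * t * inner k k"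
      by (simp add: inner_add_left inner_add_right inner_commute algebra_simps)
    also have "\<dots> = inner g g - (inner g k)\<^sup>2 / inner k k"
      using k by (simp add: t_def field_simps power2_eq_square)
    finally have "(inner g k)\<^sup>2 / inner k k \<le> 0" by simp
    moreover have "inner k k > 0" using k by simp
    ultimately show ?thesis by (simp add: divide_le_0_iff)
  qed simp
  have g0: "inner g g \<noteq> 0" using g(1) by (auto simp: C_def)
  show ?thesis
  proof (intro exI[of _ "(1 / inner g g) *\<^sub>R g"] allI)
    fix k
    have "inner g (k - f k *\<^sub>R g) = 0" using g(1) by (intro orth) (simp add: C_def)
    then show "f k = inner ((1 / inner g g) *\<^sub>R g) k"
      using g0 by (simp add: inner_diff_right field_simps)
  qed
qed

section \<open>Norming functionals\<close>

text \<open>The inequality for positive c suffices, because applying it to the inverse of c gives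
  equality; it is the form that is easily checked for infima.\<close>

definition sublinear :: "('a::real_vector \<Rightarrow> real) \<Rightarrow> bool" where
  "sublinear q \<longleftrightarrow> (\<forall>x y. q (x + y) \<le> q x + q y) \<and> (\<forall>c x. 0 < c \<longrightarrow> q (c *\<^sub>R x) \<le> c * q x)"

lemma sublinear_add: "sublinear q \<Longrightarrow> q (x + y) \<le> q x + q y"
  by (simp add: sublinear_def)

lemma sublinear_scale:
  assumes "sublinear q" "0 < c" shows "q (c *\<^sub>R x) = c * q x"
proof -
  have "q (inverse c *\<^sub>R (c *\<^sub>R x)) \<le> inverse c * q (c *\<^sub>R x)"
    using assms unfolding sublinear_def by (meson positive_imp_inverse_positive)
  then have "c * q x \<le> q (c *\<^sub>R x)" using assms(2) by (simp add: field_simps)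
  then show ?thesis using assms by (simp add: sublinear_def order.antisym)
qed

lemma sublinear_0: "sublinear q \<Longrightarrow> q 0 = 0"
  using sublinear_scale[of q 2 0] by simp

lemma sublinear_minus: "sublinear q \<Longrightarrow> - q (- x) \<le> q x"
  using sublinear_add[of q x "- x"] by (simp add: sublinear_0)

text \<open>Every sublinear functional that is not additive at \<open>y\<close> can be decreased: this makes the
  minimal sublinear functionals linear.\<close>

lemma sublinear_slide:
  assumes q: "sublinear q"
  obtains q' where "sublinear q'" "\<And>x. q' x \<le> q x" "\<And>x. q' x \<le> q (x + y) - q y"
proof
  \<comment> \<open>The infimum over all t >= 0 is what makes \<open>q'\<close> sublinear. The
    values t = 0 and t = 1 give the two upper bounds, and q (t y) <= q (x + t y) + q (- x) bounds F
    from below.\<close>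
  define F where "F x t = q (x + t *\<^sub>R y) - t * q y" for x t
  define q' where "q' x = (INF t\<in>{0..}. F x t)" for x
  have lower: "- q (- x) \<le> F x t" if "t \<in> {0..}" for x t
  proof -
    have "t * q y = q (t *\<^sub>R y)" using that sublinear_scale[OF q, of t y] sublinear_0[OF q]
      by (cases "t = 0") auto
    then show ?thesis using sublinear_add[OF q, of "x + t *\<^sub>R y" "- x"] by (simp add: F_def)
  qed
  have bb: "bdd_below (F x ` {0..})" for x using lower by (intro bdd_belowI2)
  have q'_le: "q' x \<le> F x t" if "0 \<le> t" for x t
    unfolding q'_def using bb that by (intro cINF_lower) auto
  have greatest: "z \<le> q' x" if "\<And>t. 0 \<le> t \<Longrightarrow> z \<le> F x t" for x z
    unfolding q'_def using that by (intro cINF_greatest) auto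
  show "sublinear q'" unfolding sublinear_def
  proof (intro conjI allI impI)
    fix u v
    have "q' (u + v) - F v s \<le> F u t" if "0 \<le> s" "0 \<le> t" for s t
      using q'_le[of "s + t" "u + v"] that sublinear_add[OF q, of "u + t *\<^sub>R y" "v + s *\<^sub>R y"]
      by (simp add: F_def algebra_simps)
    then have "q' (u + v) - F v s \<le> q' u" if "0 \<le> s" for s
      using that by (intro greatest)
    then have "q' (u + v) - q' u \<le> q' v"
      by (intro greatest) (simp add: algebra_simps)
    then show "q' (u + v) \<le> q' u + q' v" by simp
  next
    fix c :: real and u assume c: "0 < c"
    have "q' (c *\<^sub>R u) / c \<le> F u t" if "0 \<le> t" for t
    proof -
      have "q' (c *\<^sub>R u) \<le> F (c *\<^sub>R u) (c * t)" using that c by (intro q'_le) simp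
      also have "\<dots> = c * F u t"
        using sublinear_scale[OF q c, of "u + t *\<^sub>R y"] by (simp add: F_def algebra_simps)
      finally show ?thesis using c by (simp add: field_simps)
    qed
    then have "q' (c *\<^sub>R u) / c \<le> q' u" by (rule greatest)
    then show "q' (c *\<^sub>R u) \<le> c * q' u" using c by (simp add: field_simps)
  qed
  show "q' x \<le> q x" for x using q'_le[of 0 x] by (simp add: F_def)
  show "q' x \<le> q (x + y) - q y" for x using q'_le[of 1 x] by (simp add: F_def)
qed

text \<open>Subadditivity survives the infimum because C is a chain: the smaller of q and r can be
  used at both u and v. The bound B keeps the infima finite.\<close>

lemma sublinear_cINF_chain:
  assumes ne: "C \<noteq> {}" and sub: "\<And>q. q \<in> C \<Longrightarrow> sublinear q"
    and low: "\<And>q x. q \<in> C \<Longrightarrow> B x \<le> q x"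
    and chain: "\<And>q r. q \<in> C \<Longrightarrow> r \<in> C \<Longrightarrow> (\<forall>x. q x \<le> r x) \<or> (\<forall>x. r x \<le> q x)"
  shows "sublinear (\<lambda>x. INF q\<in>C. q x)"
  unfolding sublinear_def
proof (intro conjI allI impI)
  have bb: "bdd_below ((\<lambda>q. q x) ` C)" for x using low by (intro bdd_belowI2)
  have le: "(INF q\<in>C. q x) \<le> q x" if "q \<in> C" for q x using bb that by (intro cINF_lower)
  fix u v
  have "(INF q\<in>C. q (u + v)) - r v \<le> q u" if "q \<in> C" "r \<in> C" for q r
  proof -
    obtain s where s: "s \<in> C" "\<forall>x. s x \<le> q x" "\<forall>x. s x \<le> r x"
      using chain[of q r] \<open>q \<in> C\<close> \<open>r \<in> C\<close> by blast
    have "(INF q\<in>C. q (u + v)) \<le> s u + s v"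
      using le[OF s(1), of "u + v"] sublinear_add[OF sub[OF s(1)], of u v] by simp
    moreover have "s u \<le> q u" "s v \<le> r v" using s by auto
    ultimately show ?thesis by linarith
  qed
  then have "(INF q\<in>C. q (u + v)) - r v \<le> (INF q\<in>C. q u)" if "r \<in> C" for r
    using that ne by (intro cINF_greatest)
  then have "(INF q\<in>C. q (u + v)) - (INF q\<in>C. q u) \<le> (INF q\<in>C. q v)"
    using ne by (intro cINF_greatest) (auto simp: algebra_simps)
  then show "(INF q\<in>C. q (u + v)) \<le> (INF q\<in>C. q u) + (INF q\<in>C. q v)" by simp
next
  have bb: "bdd_below ((\<lambda>q. q x) ` C)" for x using low by (intro bdd_belowI2)
  fix c :: real and u assume c: "0 < c"
  have "(INF q\<in>C. q (c *\<^sub>R u)) / c \<le> q u" if "q \<in> C" for q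
  proof -
    have "(INF q\<in>C. q (c *\<^sub>R u)) \<le> q (c *\<^sub>R u)" using bb that by (intro cINF_lower)
    then show ?thesis using sublinear_scale[OF sub[OF that] c] c by (simp add: field_simps)
  qed
  then have "(INF q\<in>C. q (c *\<^sub>R u)) / c \<le> (INF q\<in>C. q u)" using ne by (intro cINF_greatest)
  then show "(INF q\<in>C. q (c *\<^sub>R u)) \<le> c * (INF q\<in>C. q u)" using c by (simp add: field_simps)
qed

text \<open>Hahn-Banach by Zorn's lemma on the sublinear functionals below p. They all stay above -
  p (- x), so chains have real infima; a minimal one cannot be slid down, which makes it
  superadditive as well.\<close>

lemma linear_minorant_exists:
  assumes p: "sublinear p"
  shows "\<exists>f. linear f \<and> (\<forall>x. f x \<le> p x)"
proof -
  define A where "A = {q. sublinear q \<and> (\<forall>x. q x \<le> p x)}"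
  \<comment> \<open>The order is reversed, since Zorn's lemma yields maximal elements and a minimal
    functional is wanted.\<close>
  define P where "P q r \<longleftrightarrow> (\<forall>x. r x \<le> q x)" for q r :: "'a \<Rightarrow> real"
  have low: "- p (- x) \<le> q x" if "q \<in> A" for q x
    using that sublinear_minus[of q x] unfolding A_def by (smt (verit) mem_Collect_eq)
  have "\<exists>m\<in>A. \<forall>q\<in>A. P m q \<longrightarrow> q = m"
  proof (rule predicate_Zorn)
    show "partial_order_on A (relation_of P A)"
      by (intro partial_order_on_relation_ofI) (auto simp: P_def intro!: ext intro: order.trans order.antisym)
    show "\<exists>u\<in>A. \<forall>q\<in>C. P q u" if C: "C \<in> Chains (relation_of P A)" for C
    proof (cases "C = {}")
      case True then show ?thesis using p by (auto simp: A_def)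
    next
      case False
      have sub: "C \<subseteq> A" using C by (auto simp: Chains_def relation_of_def)
      have bb: "bdd_below ((\<lambda>q. q x) ` C)" for x
        using low sub by (intro bdd_belowI2[of _ "- p (- x)"]) auto
      have le: "(INF q\<in>C. q x) \<le> q x" if "q \<in> C" for q x using bb that by (intro cINF_lower)
      have "sublinear (\<lambda>x. INF q\<in>C. q x)"
      proof (rule sublinear_cINF_chain[OF False, of "\<lambda>x. - p (- x)"])
        show "(\<forall>x. q x \<le> r x) \<or> (\<forall>x. r x \<le> q x)" if "q \<in> C" "r \<in> C" for q r
          using C that by (auto simp: Chains_def relation_of_def P_def)
      qed (use sub low in \<open>auto simp: A_def\<close>)
      moreover have "(INF q\<in>C. q x) \<le> p x" for x
      proof -
        obtain q where "q \<in> C" using False by blast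
        moreover from this have "q x \<le> p x" using sub by (auto simp: A_def)
        ultimately show ?thesis using le[of q x] by linarith
      qed
      ultimately show ?thesis using le by (intro bexI[of _ "\<lambda>x. INF q\<in>C. q x"]) (auto simp: P_def A_def)
    qed
  qed
  then obtain m where m: "m \<in> A" "\<And>q. q \<in> A \<Longrightarrow> (\<And>x. q x \<le> m x) \<Longrightarrow> q = m" by (auto simp: P_def)
  have sm: "sublinear m" using m by (simp add: A_def)
  have super: "m x \<le> m (x + y) - m y" for x y
  proof -
    obtain q where q: "sublinear q" "\<And>x. q x \<le> m x" "\<And>x. q x \<le> m (x + y) - m y"
      using sublinear_slide[OF sm, of y] by blast
    have "q x \<le> p x" for x using q(2)[of x] m(1) by (auto simp: A_def intro: order.trans)
    then have "q = m" using q(1,2) by (intro m(2)) (auto simp: A_def)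
    then show ?thesis using q(3) by auto
  qed
  have add: "m (x + y) = m x + m y" for x y
    using super[of x y] sublinear_add[OF sm, of x y] by linarith
  have neg: "m (- x) = - m x" for x using add[of x "- x"] by (simp add: sublinear_0[OF sm])
  have "m (c *\<^sub>R x) = c * m x" for c x
  proof (cases c "0::real" rule: linorder_cases)
    case less
    then show ?thesis using sublinear_scale[OF sm, of "- c" x] neg[of "c *\<^sub>R x"] by simp
  qed (simp_all add: sublinear_0[OF sm] sublinear_scale[OF sm])
  then have "linear m" using add by (intro linearI) auto
  then show ?thesis using m(1) by (auto simp: A_def)
qed

text \<open>Sliding p at a first gives q (- a) <= - p a, so that every linear f below q satisfies f
  a >= p a.\<close>

lemma seminorm_norming_functional:
  fixes p :: "'a::real_vector \<Rightarrow> real"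
  assumes p: "seminorm p"
  shows "\<exists>f. linear f \<and> (\<forall>x. \<bar>f x\<bar> \<le> p x) \<and> f a = p a"
proof -
  have hom: "p (c *\<^sub>R x) = \<bar>c\<bar> * p x" for c x using p by (auto simp: seminorm_def)
  have "sublinear p" using p by (auto simp: seminorm_def sublinear_def)
  then obtain q where q: "sublinear q" "\<And>x. q x \<le> p x" "\<And>x. q x \<le> p (x + a) - p a"
    using sublinear_slide[of p a] by blast
  then obtain f where f: "linear f" "\<And>x. f x \<le> q x" using linear_minorant_exists by blast
  have p0: "p 0 = 0" using hom[of 0 0] by simp
  have "f x \<le> p x" for x using f(2)[of x] q(2)[of x] by linarith
  moreover have "- f x \<le> p x" for x
    using calculation[of "- x"] hom[of "-1" x] by (simp add: linear_neg[OF f(1)])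
  moreover have "p a \<le> f a"
    using f(2)[of "- a"] q(3)[of "- a"] p0 by (simp add: linear_neg[OF f(1)])
  ultimately show ?thesis using f(1) by (metis abs_le_iff order.antisym)
qed

section \<open>The dual of a separable Frechet space\<close>

lemma topological_dual_linear: "e \<in> topological_dual \<Longrightarrow> linear e"
  and topological_dual_continuous: "e \<in> topological_dual \<Longrightarrow> continuous_on UNIV e"
  by (auto simp: topological_dual_def)

lemma topological_dual_measurable [measurable_dest]:
  "e \<in> topological_dual \<Longrightarrow> e \<in> borel_measurable borel"
  by (simp add: borel_measurable_continuous_onI topological_dual_continuous)

lemma topological_dual_zero: "(\<lambda>x. 0) \<in> topological_dual"
  by (simp add: topological_dual_def linear_zero)

lemma topological_dual_add:
  "e \<in> topological_dual \<Longrightarrow> f \<in> topological_dual \<Longrightarrow> (\<lambda>x. e x + f x) \<in> topological_dual"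
  by (auto simp: topological_dual_def intro: linear_compose_add continuous_intros)

lemma topological_dual_scale:
  "e \<in> topological_dual \<Longrightarrow> (\<lambda>x. c * e x) \<in> topological_dual"
  using linear_compose_scale_right[of e c]
  by (auto simp: topological_dual_def intro!: continuous_intros)

lemma topological_dual_diff:
  "e \<in> topological_dual \<Longrightarrow> f \<in> topological_dual \<Longrightarrow> (\<lambda>x. e x - f x) \<in> topological_dual"
  using topological_dual_add[of e "\<lambda>x. - 1 * f x"] topological_dual_scale[of f "- 1"] by simp

text \<open>A countable family of functionals that is norming for each seminorm \<open>p\<^sub>i\<close> of the
  space, i.e. \<open>p\<^sub>i = sup\<^sub>n \<bar>e\<^sub>i\<^sub>,\<^sub>n\<bar>\<close>, so that topology, completeness and Borel sets can be read off
  from the functionals alone.\<close>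

definition dual_nbhd :: "(nat \<Rightarrow> nat \<Rightarrow> 'w::real_vector \<Rightarrow> real) \<Rightarrow> nat \<Rightarrow> 'w \<Rightarrow> 'w set" where
  "dual_nbhd e m w = {y. \<forall>i\<le>m. \<forall>n. \<bar>e i n y - e i n w\<bar> \<le> 1 / real (Suc m)}"

text \<open>The condition \<open>complete\<close> is completeness in coordinates: countably many
  inequalities suffice for an array a to come from a point of the space. This is what later
  reassembles measurable coordinates into a measurable map.\<close>

locale norming_family =
  fixes e :: "nat \<Rightarrow> nat \<Rightarrow> 'w::{frechet_space, second_countable_topology} \<Rightarrow> real"
    and D :: "nat \<Rightarrow> 'w"
  assumes dual: "\<And>i n. e i n \<in> topological_dual"
    and separating: "\<And>x y. (\<And>i n. e i n x = e i n y) \<Longrightarrow> x = y"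
    and dense: "\<And>m x. \<exists>l. x \<in> dual_nbhd e m (D l)"
    and complete: "\<And>a. (\<And>m. \<exists>l. \<forall>i\<le>m. \<forall>n. \<bar>a i n - e i n (D l)\<bar> \<le> 1 / real (Suc m)) \<Longrightarrow>
      \<exists>w. \<forall>i n. e i n w = a i n"
    and nbhd: "\<And>m w. \<exists>U. open U \<and> w \<in> U \<and> U \<subseteq> dual_nbhd e m w"
    and basis: "\<And>U x. open U \<Longrightarrow> x \<in> U \<Longrightarrow>
      \<exists>l m. x \<in> dual_nbhd e m (D l) \<and> dual_nbhd e m (D l) \<subseteq> U"

text \<open>For every seminorm \<open>p i\<close> and every point \<open>D n\<close> of a dense
  sequence, \<open>e i n\<close> is a functional below \<open>p i\<close> that attains it at
  \<open>D n\<close>. Density extends this to all points: bounding every \<open>e i n\<close> by c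
  amounts to bounding \<open>p i\<close> by c.\<close>

lemma norming_family_exists:
  "\<exists>(e :: nat \<Rightarrow> nat \<Rightarrow> 'w::{frechet_space, second_countable_topology} \<Rightarrow> real) D. norming_family e D"
proof -
  obtain p :: "nat \<Rightarrow> 'w \<Rightarrow> real" where semi: "\<And>n. seminorm (p n)"
    and sep: "\<And>x. (\<And>n. p n x = 0) \<Longrightarrow> x = 0"
    and op: "\<And>U. open U \<longleftrightarrow> (\<forall>x\<in>U. \<exists>n. \<exists>\<epsilon>>0. {y. \<forall>i\<le>n. p i (y - x) < \<epsilon>} \<subseteq> U)"
    and compl: "\<And>X. (\<And>n \<epsilon>. 0 < \<epsilon> \<Longrightarrow> \<exists>N. \<forall>k\<ge>N. \<forall>l\<ge>N. p n (X k - X l) < \<epsilon>) \<Longrightarrow>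
      \<exists>L. \<forall>n. (\<lambda>k. p n (X k - L)) \<longlonglongrightarrow> 0"
    using frechet_seminorms[where ?'a='w] by (elim exE conjE) blast
  have tri: "p i (x + y) \<le> p i x + p i y" for i x y using semi by (auto simp: seminorm_def)
  have hom: "p i (c *\<^sub>R x) = \<bar>c\<bar> * p i x" for i c x using semi by (auto simp: seminorm_def)
  have p0: "p i 0 = 0" for i using hom[of i 0 0] by simp
  have pm: "p i (x - y) = p i (y - x)" for i x y using hom[of i "-1" "x - y"] by simp
  have tri3: "p i (x - z) \<le> p i (x - y) + p i (y - z)" for i x y z
    using tri[of i "x - y" "y - z"] by simp
  have ball: "open {y. \<forall>i\<le>n. p i (y - x) < \<epsilon>}" for x n \<epsilon>
    unfolding op
  proof
    fix y assume y: "y \<in> {y. \<forall>i\<le>n. p i (y - x) < \<epsilon>}"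
    define \<delta> where "\<delta> = Min ((\<lambda>i. \<epsilon> - p i (y - x)) ` {..n})"
    have "0 < \<delta>" using y by (auto simp: \<delta>_def)
    moreover have "\<delta> \<le> \<epsilon> - p i (y - x)" if "i \<le> n" for i
      unfolding \<delta>_def using that by (intro Min_le) auto
    then have "p i (z - x) < \<epsilon>" if "i \<le> n" "p i (z - y) < \<delta>" for i z
      using tri3[of i z x y] that by fastforce
    ultimately show "\<exists>n'. \<exists>\<epsilon>'>0. {z. \<forall>i\<le>n'. p i (z - y) < \<epsilon>'} \<subseteq> {y. \<forall>i\<le>n. p i (y - x) < \<epsilon>}"
      by (intro exI[of _ n] exI[of _ \<delta>]) auto
  qed
  obtain D' :: "'w set" where D': "countable D'" "\<And>U. open U \<Longrightarrow> U \<noteq> {} \<Longrightarrow> \<exists>d\<in>D'. d \<in> U"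
    using countable_dense_setE by blast
  have "D' \<noteq> {}" using D'(2)[of UNIV] by auto
  then obtain D :: "nat \<Rightarrow> 'w" where D: "range D = D'" using range_from_nat_into[of D'] D'(1) by metis
  have close: "\<exists>l. \<forall>i\<le>m. p i (x - D l) < \<epsilon>" if "0 < \<epsilon>" for m x \<epsilon>
  proof -
    have "x \<in> {y. \<forall>i\<le>m. p i (y - x) < \<epsilon>}" using that p0 by simp
    then obtain d where "d \<in> D'" "\<forall>i\<le>m. p i (d - x) < \<epsilon>" using D'(2)[OF ball, of m x \<epsilon>] by blast
    moreover obtain l where "d = D l" using D \<open>d \<in> D'\<close> by blast
    ultimately show ?thesis by (metis pm)
  qed
  have "\<forall>i n. \<exists>f. linear f \<and> (\<forall>x. \<bar>f x\<bar> \<le> p i x) \<and> f (D n) = p i (D n)"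
    using seminorm_norming_functional[OF semi] by blast
  then obtain e where lin: "\<And>i n. linear (e i n)" and le: "\<And>i n x. \<bar>e i n x\<bar> \<le> p i x"
    and eq: "\<And>i n. e i n (D n) = p i (D n)" by metis
  note diff = linear_diff[OF lin]
  have le_diff: "\<bar>e i n x - e i n y\<bar> \<le> p i (x - y)" for i n x y
    using le[of i n "x - y"] by (simp add: diff)
  have norming: "p i x \<le> c" if c: "\<And>n. \<bar>e i n x\<bar> \<le> c" for i x c
  proof (rule field_le_epsilon)
    fix \<epsilon> :: real assume "0 < \<epsilon>"
    then obtain l where l: "p i (x - D l) < \<epsilon> / 2" using close[of "\<epsilon>/2" i x] by auto
    have "p i x \<le> p i (x - D l) + p i (D l)" using tri[of i "x - D l" "D l"] by simp
    then show "p i x \<le> c + \<epsilon>" using l le_diff[of i l x "D l"] c[of l] by (simp add: eq)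
  qed
  have nbhd_iff: "y \<in> dual_nbhd e m w \<longleftrightarrow> (\<forall>i\<le>m. p i (y - w) \<le> 1 / real (Suc m))" for y m w
  proof -
    have "(\<forall>n. \<bar>e i n y - e i n w\<bar> \<le> c) \<longleftrightarrow> p i (y - w) \<le> c" for i c
      using norming[of i "y - w" c] le_diff[of i _ y w] by (auto simp: diff intro: order.trans)
    then show ?thesis unfolding dual_nbhd_def by blast
  qed
  have "norming_family e D"
  proof
    fix i n
    have "open (e i n -` V)" if V: "open V" for V
      unfolding op
    proof
      fix x assume "x \<in> e i n -` V"
      then obtain \<epsilon> where \<epsilon>: "0 < \<epsilon>" "\<And>t. \<bar>t - e i n x\<bar> < \<epsilon> \<Longrightarrow> t \<in> V"
        using V by (auto simp: open_dist dist_real_def)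
      have "e i n y \<in> V" if "\<forall>i'\<le>i. p i' (y - x) < \<epsilon>" for y
        using that le_diff[of i n y x] by (intro \<epsilon>(2)) (meson order.refl order.strict_trans1)
      then show "\<exists>n'. \<exists>\<epsilon>>0. {y. \<forall>i\<le>n'. p i (y - x) < \<epsilon>} \<subseteq> e i n -` V"
        using \<epsilon>(1) by (intro exI[of _ i] exI[of _ \<epsilon>]) auto
    qed
    then have "continuous_on UNIV (e i n)" by (simp add: continuous_on_open_vimage)
    then show "e i n \<in> topological_dual" using lin by (simp add: topological_dual_def)
  next
    fix x y assume eq_xy: "\<And>i n. e i n x = e i n y"
    have "p i (x - y) = 0" for i
    proof (rule order.antisym)
      show "p i (x - y) \<le> 0" by (rule norming) (simp add: diff eq_xy)
      show "0 \<le> p i (x - y)" using le[of i 0 "x - y"] by linarith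
    qed
    then show "x = y" using sep[of "x - y"] by simp
  next
    fix m x
    obtain l where "\<forall>i\<le>m. p i (x - D l) < 1 / real (Suc m)"
      using close[of "1 / real (Suc m)" m x] by auto
    then show "\<exists>l. x \<in> dual_nbhd e m (D l)" by (intro exI[of _ l]) (simp add: nbhd_iff less_imp_le)
  next
    fix a assume "\<And>m. \<exists>l. \<forall>i\<le>m. \<forall>n. \<bar>a i n - e i n (D l)\<bar> \<le> 1 / real (Suc m)"
    then obtain l where l: "\<And>m i n. i \<le> m \<Longrightarrow> \<bar>a i n - e i n (D (l m))\<bar> \<le> 1 / real (Suc m)" by metis
    have lim0: "(\<lambda>m. 1 / real (Suc m)) \<longlonglongrightarrow> 0" using LIMSEQ_Suc[OF lim_1_over_n] by simp
    \<comment> \<open>The approximation of a is uniform in n, so by \<open>norming\<close> it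
      controls the seminorms and makes \<open>D (l m)\<close> a Cauchy sequence.\<close>
    have "\<exists>L. \<forall>i. (\<lambda>k. p i (D (l k) - L)) \<longlonglongrightarrow> 0"
    proof (rule compl)
      fix i :: nat and \<epsilon> :: real assume "0 < \<epsilon>"
      then obtain N where N: "\<And>m. N \<le> m \<Longrightarrow> 1 / real (Suc m) < \<epsilon> / 2"
        using order_tendstoD(2)[OF lim0, of "\<epsilon>/2"] by (auto simp: eventually_sequentially)
      have "p i (D (l k) - D (l m)) < \<epsilon>" if "max N i \<le> k" "max N i \<le> m" for k m
      proof -
        have "\<bar>e i n (D (l k) - D (l m))\<bar> \<le> 1 / real (Suc k) + 1 / real (Suc m)" for n
          using l[of i k n] l[of i m n] that by (simp add: diff)
        then have "p i (D (l k) - D (l m)) \<le> 1 / real (Suc k) + 1 / real (Suc m)" by (rule norming)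
        moreover have "1 / real (Suc k) < \<epsilon> / 2" "1 / real (Suc m) < \<epsilon> / 2" using N[of k] N[of m] that by simp_all
        ultimately show ?thesis by linarith
      qed
      then show "\<exists>N. \<forall>k\<ge>N. \<forall>m\<ge>N. p i (D (l k) - D (l m)) < \<epsilon>" by blast
    qed
    then obtain L where L: "\<And>i. (\<lambda>k. p i (D (l k) - L)) \<longlonglongrightarrow> 0" by blast
    have "e i n L = a i n" for i n
    proof (rule LIMSEQ_unique)
      have "(\<lambda>k. e i n (D (l k)) - e i n L) \<longlonglongrightarrow> 0"
        by (rule Lim_null_comparison[OF _ L[of i]]) (simp add: le_diff)
      then show "(\<lambda>k. e i n (D (l k))) \<longlonglongrightarrow> e i n L" by (rule LIM_zero_cancel)
      have "(\<lambda>k. e i n (D (l k)) - a i n) \<longlonglongrightarrow> 0"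
      proof (rule Lim_null_comparison[OF _ lim0])
        show "\<forall>\<^sub>F m in sequentially. norm (e i n (D (l m)) - a i n) \<le> 1 / real (Suc m)"
          using l[of i _ n]
          by (intro eventually_sequentiallyI[of i]) (simp add: abs_minus_commute del: of_nat_Suc)
      qed
      then show "(\<lambda>k. e i n (D (l k))) \<longlonglongrightarrow> a i n" by (rule LIM_zero_cancel)
    qed
    then show "\<exists>w. \<forall>i n. e i n w = a i n" by blast
  next
    fix m w
    show "\<exists>U. open U \<and> w \<in> U \<and> U \<subseteq> dual_nbhd e m w"
      by (intro exI[of _ "{y. \<forall>i\<le>m. p i (y - w) < 1 / real (Suc m)}"])
        (use ball in \<open>auto simp: nbhd_iff p0 less_imp_le\<close>)
  next
    fix U and x :: 'w assume "open U" "x \<in> U"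
    then obtain n \<epsilon> where \<epsilon>: "0 < \<epsilon>" "{y. \<forall>i\<le>n. p i (y - x) < \<epsilon>} \<subseteq> U" unfolding op by blast
    obtain m0 where m0: "1 / real (Suc m0) < \<epsilon> / 2"
      using \<epsilon>(1) reals_Archimedean[of "\<epsilon>/2"] by (auto simp: inverse_eq_divide)
    \<comment> \<open>Both x and the points of the neighbourhood are within 1 / (m + 1) of the
      centre \<open>D l\<close>, hence the factor 1/2; m >= n covers all seminorms up to n.\<close>
    define m where "m = max n m0"
    have m: "1 / real (Suc m) < \<epsilon> / 2" "n \<le> m"
      using m0 frac_le[of 1 1 "real (Suc m0)" "real (Suc m)"] by (auto simp: m_def simp del: of_nat_Suc)
    obtain l where l: "\<forall>i\<le>m. p i (x - D l) < 1 / real (Suc m)"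
      using close[of "1 / real (Suc m)" m x] by auto
    have "dual_nbhd e m (D l) \<subseteq> {y. \<forall>i\<le>n. p i (y - x) < \<epsilon>}"
    proof (intro subsetI CollectI allI impI)
      fix y i assume "y \<in> dual_nbhd e m (D l)" "i \<le> n"
      moreover from this have "i \<le> m" using m(2) by simp
      ultimately have "p i (y - D l) \<le> 1 / real (Suc m)" "p i (D l - x) < 1 / real (Suc m)"
        using l[rule_format, of i] pm[of i x "D l"] by (simp_all add: nbhd_iff)
      then show "p i (y - x) < \<epsilon>" using tri3[of i y x "D l"] m(1) by linarith
    qed
    moreover have "x \<in> dual_nbhd e m (D l)" using l by (auto simp: nbhd_iff less_imp_le)
    ultimately show "\<exists>l m. x \<in> dual_nbhd e m (D l) \<and> dual_nbhd e m (D l) \<subseteq> U" using \<epsilon>(2) by blast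
  qed
  then show ?thesis by blast
qed

context norming_family
begin

lemma linear_e: "linear (e i n)"
  using dual by (rule topological_dual_linear)

text \<open>By \<open>basis\<close> an open set is a countable union of sets
  \<open>dual_nbhd e m (D l)\<close>, and their preimages are described by countably many real
  inequalities.\<close>

lemma measurable_coordinatesI:
  assumes [measurable]: "\<And>i n. (\<lambda>x. e i n (f x)) \<in> borel_measurable M"
  shows "f \<in> borel_measurable M"
proof (rule borel_measurableI)
  fix U :: "'w set" assume U: "open U"
  define K where "K = {(l, m). dual_nbhd e m (D l) \<subseteq> U}"
  have "U = (\<Union>(l, m)\<in>K. dual_nbhd e m (D l))" using basis[OF U] by (force simp: K_def)
  then have "f -` U \<inter> space M =
      (\<Union>(l, m)\<in>K. {x \<in> space M. \<forall>i\<le>m. \<forall>n. \<bar>e i n (f x) - e i n (D l)\<bar> \<le> 1 / real (Suc m)})"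
    by (auto simp: dual_nbhd_def)
  also have "\<dots> \<in> sets M"
    by (intro sets.countable_UN') (auto split: prod.splits)
  finally show "f -` U \<inter> space M \<in> sets M" .
qed

end

section \<open>Borel measurability of the vector operations\<close>

lemma measurable_dualI:
  fixes f :: "'a \<Rightarrow> 'w::{frechet_space, second_countable_topology}"
  assumes "\<And>e. e \<in> topological_dual \<Longrightarrow> (\<lambda>x. e (f x)) \<in> borel_measurable M"
  shows "f \<in> borel_measurable M"
proof -
  obtain e D where "norming_family (e :: nat \<Rightarrow> nat \<Rightarrow> 'w \<Rightarrow> real) D" using norming_family_exists by blast
  then interpret norming_family e D .
  show ?thesis by (intro measurable_coordinatesI assms dual)
qed

lemma frechet_measurable_add:
  fixes f g :: "'a \<Rightarrow> 'w::{frechet_space, second_countable_topology}"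
  assumes "f \<in> borel_measurable M" "g \<in> borel_measurable M"
  shows "(\<lambda>x. f x + g x) \<in> borel_measurable M"
proof (rule measurable_dualI)
  fix e :: "'w \<Rightarrow> real" assume e: "e \<in> topological_dual"
  note [measurable] = assms topological_dual_measurable[OF e]
  show "(\<lambda>x. e (f x + g x)) \<in> borel_measurable M"
    by (simp add: linear_add[OF topological_dual_linear[OF e]])
qed

lemma frechet_measurable_scaleR:
  fixes f :: "'a \<Rightarrow> 'w::{frechet_space, second_countable_topology}"
  assumes "c \<in> borel_measurable M" "f \<in> borel_measurable M"
  shows "(\<lambda>x. c x *\<^sub>R f x) \<in> borel_measurable M"
proof (rule measurable_dualI)
  fix e :: "'w \<Rightarrow> real" assume e: "e \<in> topological_dual"
  note [measurable] = assms topological_dual_measurable[OF e]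
  show "(\<lambda>x. e (c x *\<^sub>R f x)) \<in> borel_measurable M"
    by (simp add: linear_scale[OF topological_dual_linear[OF e]])
qed

lemma frechet_measurable_diff:
  fixes f g :: "'a \<Rightarrow> 'w::{frechet_space, second_countable_topology}"
  assumes "f \<in> borel_measurable M" "g \<in> borel_measurable M"
  shows "(\<lambda>x. f x - g x) \<in> borel_measurable M"
  using frechet_measurable_add[OF assms(1) frechet_measurable_scaleR[OF borel_measurable_const[of "-1"] assms(2)]]
  by simp

lemmas frechet_measurable [measurable] =
  frechet_measurable_add frechet_measurable_diff frechet_measurable_scaleR

lemma frechet_pred_eq:
  fixes f g :: "'a \<Rightarrow> 'w::{frechet_space, second_countable_topology}"
  assumes [measurable]: "f \<in> borel_measurable M" "g \<in> borel_measurable M"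
  shows "Measurable.pred M (\<lambda>x. f x = g x)"
proof -
  obtain e D where "norming_family (e :: nat \<Rightarrow> nat \<Rightarrow> 'w \<Rightarrow> real) D" using norming_family_exists by blast
  then interpret norming_family e D .
  have [measurable]: "e i n \<in> borel_measurable borel" for i n by (rule topological_dual_measurable[OF dual])
  have "(\<lambda>x. f x = g x) = (\<lambda>x. \<forall>i n. e i n (f x) = e i n (g x))" using separating by fastforce
  then show ?thesis by simp
qed

section \<open>Measurability of the Cameron--Martin norm\<close>

context abstract_wiener_space
begin

lemma riesz_vec: "e \<in> topological_dual \<Longrightarrow> e (j h) = inner (riesz_vec j e) h"
proof -
  assume e: "e \<in> topological_dual"
  have "linear (\<lambda>h. e (j h))"
    using linear_compose[OF linear_j topological_dual_linear[OF e]] by (simp add: o_def)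
  moreover have "continuous_on UNIV (\<lambda>h. e (j h))"
    using continuous_on_compose2[OF topological_dual_continuous[OF e] continuous_j] by simp
  ultimately obtain k where k: "\<forall>h. e (j h) = inner k h" using riesz_representation by blast
  have "\<exists>!k. \<forall>h. e (j h) = inner k h"
  proof (rule ex1I[of _ k])
    show "\<forall>h. e (j h) = inner k h" by (rule k)
  next
    fix k' assume "\<forall>h. e (j h) = inner k' h"
    then have "inner (k' - k) (k' - k) = 0" using k by (metis inner_diff_left right_minus_eq)
    then show "k' = k" by simp
  qed
  from theI'[OF this] have "\<forall>h. e (j h) = inner (riesz_vec j e) h"
    unfolding riesz_vec_def .
  then show "e (j h) = inner (riesz_vec j e) h" ..
qed

lemma riesz_vec_eqI:
  assumes "e \<in> topological_dual" "\<And>h. e (j h) = inner k h"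
  shows "riesz_vec j e = k"
  by (rule vector_eq_rdot[THEN iffD1]) (use riesz_vec[OF assms(1)] assms(2) in metis)

text \<open>If every neighbourhood of w meets the image, then the vectors h of the ball with j h
  near w form nested nonempty closed convex sets; a common point has all coordinates of w. These
  images are the sublevel sets of \<open>cm_norm_sq\<close>, which is thereby a Borel
  function.\<close>

lemma closed_cm_cball: "closed (j ` cball 0 r)"
proof -
  obtain e D where "norming_family (e :: nat \<Rightarrow> nat \<Rightarrow> 'w \<Rightarrow> real) D" using norming_family_exists by blast
  then interpret norming_family e D .
  have "\<exists>U. open U \<and> w \<in> U \<and> U \<subseteq> - (j ` cball 0 r)" if w: "w \<notin> j ` cball 0 r" for w
  proof (rule ccontr)
    assume neg: "\<not> ?thesis"
    have lin: "linear (\<lambda>h. e i n (j h))" for i n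
      using linear_compose[OF linear_j linear_e] by (simp add: o_def)
    define C where "C m = cball 0 r \<inter> (\<Inter>i\<in>{..m}. \<Inter>n. {h. \<bar>e i n (j h) - e i n w\<bar> \<le> 1 / real (Suc m)})" for m
    have "\<exists>h. \<forall>m. h \<in> C m"
    proof (rule nested_closed_convex_Inter_nonempty)
      fix m
      have cont: "continuous_on UNIV (\<lambda>h. \<bar>e i n (j h) - e i n w\<bar>)" for i n
        by (intro continuous_intros continuous_on_compose2[OF topological_dual_continuous[OF dual] continuous_j]) auto
      show "closed (C m)" unfolding C_def
        by (intro closed_Int closed_INT closed_Collect_le cont continuous_on_const ballI) auto
      have "convex {h. \<bar>e i n (j h) - e i n w\<bar> \<le> c}" for i n c
      proof -
        have "{h. \<bar>e i n (j h) - e i n w\<bar> \<le> c} = (\<lambda>h. e i n (j h)) -` {e i n w - c .. e i n w + c}"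
          by auto
        then show ?thesis using convex_linear_vimage[OF lin] by simp
      qed
      then show "convex (C m)" unfolding C_def by (intro convex_Int convex_INT) auto
      obtain U where "open U" "w \<in> U" "U \<subseteq> dual_nbhd e m w" using nbhd by blast
      then show "C m \<noteq> {}" using neg by (fastforce simp: C_def dual_nbhd_def)
    next
      show "decseq C"
      proof (rule decseq_SucI)
        fix m
        have "1 / real (Suc (Suc m)) \<le> 1 / real (Suc m)" by (simp add: frac_le)
        then show "C (Suc m) \<subseteq> C m" unfolding C_def
          by (intro Int_mono order.refl INT_anti_mono Collect_mono) (auto simp del: of_nat_Suc)
      qed
      show "bounded (C 0)" by (rule bounded_subset[OF bounded_cball[of 0 r]]) (auto simp: C_def)
    qed
    then obtain h where h: "\<And>m. h \<in> C m" by blast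
    have "e i n (j h) = e i n w" for i n
    proof -
      have "\<bar>e i n (j h) - e i n w\<bar> \<le> 0"
      proof (rule LIMSEQ_le_const)
        show "(\<lambda>m. 1 / real (Suc m)) \<longlonglongrightarrow> 0" using LIMSEQ_Suc[OF lim_1_over_n] by simp
        show "\<exists>N. \<forall>m\<ge>N. \<bar>e i n (j h) - e i n w\<bar> \<le> 1 / real (Suc m)"
          using h by (intro exI[of _ i]) (auto simp: C_def)
      qed
      then show ?thesis by simp
    qed
    then have "j h = w" by (rule separating)
    then show False using w h[of 0] by (auto simp: C_def)
  qed
  then have "open (- (j ` cball 0 r))" by (auto simp: open_subopen[of "- (j ` cball 0 r)"])
  then show ?thesis by (simp add: closed_def)
qed

lemma cm_norm_sq_j [simp]: "cm_norm_sq j (j h) = ennreal ((norm h)\<^sup>2)"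
  by (simp add: cm_norm_sq_def inv_f_f[OF inj_j])

lemma cm_norm_sq_finite: "cm_norm_sq j w < \<infinity> \<Longrightarrow> \<exists>h. w = j h"
  by (auto simp: cm_norm_sq_def split: if_splits)

lemma cm_norm_sq_minus: "cm_norm_sq j (- w) = cm_norm_sq j w"
proof (cases "w \<in> range j")
  case True
  then obtain h where "w = j h" by auto
  then show ?thesis using linear_neg[OF linear_j, of h] cm_norm_sq_j[of "- h"] by simp
next
  case False
  have "- w \<notin> range j"
  proof
    assume "- w \<in> range j"
    then obtain h where "- w = j h" by auto
    then have "w = j (- h)" using linear_neg[OF linear_j, of h] by (metis add.inverse_inverse)
    then show False using False by simp
  qed
  then show ?thesis using False by (simp add: cm_norm_sq_def)
qed

lemma cm_norm_sq_measurable [measurable]: "cm_norm_sq j \<in> borel_measurable borel"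
proof (rule borel_measurableI_le)
  fix c :: ennreal
  show "{w \<in> space borel. cm_norm_sq j w \<le> c} \<in> sets borel"
  proof (cases c rule: ennreal_cases)
    case (real r)
    have iff: "cm_norm_sq j (j h) \<le> c \<longleftrightarrow> norm h \<le> sqrt r" for h
      using real real_sqrt_le_iff[of "(norm h)\<^sup>2" r] by simp
    have "{w. cm_norm_sq j w \<le> c} = j ` cball 0 (sqrt r)"
    proof (intro set_eqI iffI)
      fix w assume w: "w \<in> {w. cm_norm_sq j w \<le> c}"
      then have "cm_norm_sq j w < \<infinity>" using real by (auto intro: order.strict_trans1)
      then obtain h where "w = j h" using cm_norm_sq_finite by blast
      then show "w \<in> j ` cball 0 (sqrt r)" using w iff by simp
    qed (use iff in auto)
    then show ?thesis using closed_cm_cball by simp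
  qed simp
qed

end

section \<open>Measures are determined by the laws of continuous functionals\<close>

lemma density_const_cancel:
  assumes c: "0 < c" and eq: "density M (\<lambda>_. ennreal c) = density N (\<lambda>_. ennreal c)"
    and sets: "sets M = sets N"
  shows "M = N"
proof (rule measure_eqI[OF sets])
  fix A assume A: "A \<in> sets M"
  have "ennreal c * emeasure M A = ennreal c * emeasure N A"
    using arg_cong[OF eq, of "\<lambda>K. emeasure K A"] A sets by (simp add: emeasure_density_const)
  then show "emeasure M A = emeasure N A" using c by (simp add: ennreal_mult_cancel_left)
qed

text \<open>The value of the characteristic function at 0 is the total mass. If it is not 0, the
  same constant normalizes both measures and Levy's uniqueness theorem applies.\<close>

lemma finite_measure_eqI_char:
  fixes M N :: "real measure"
  assumes M: "finite_measure M" "sets M = sets borel" and N: "finite_measure N" "sets N = sets borel"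
    and char: "char M = char N"
  shows "M = N"
proof -
  interpret M: finite_measure M by fact
  interpret N: finite_measure N by fact
  have sp: "space M = UNIV" "space N = UNIV"
    using sets_eq_imp_space_eq[OF M(2)] sets_eq_imp_space_eq[OF N(2)] by simp_all
  have meas: "measure M UNIV = measure N UNIV"
    using fun_cong[OF char, of 0] sp by (simp add: char_def)
  show ?thesis
  proof (cases "measure M UNIV = 0")
    case True
    then have "emeasure M A = 0" "emeasure N A = 0" for A
      using meas emeasure_mono[of A UNIV M] emeasure_mono[of A UNIV N] M N sp
      by (auto simp: M.emeasure_eq_measure N.emeasure_eq_measure measure_le_0_iff
          intro!: antisym[OF order_trans[OF M.bounded_measure]] antisym[OF order_trans[OF N.bounded_measure]])
    then show ?thesis using M N by (intro measure_eqI) auto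
  next
    case False
    define c where "c = 1 / measure M UNIV"
    have c: "0 < c" using False measure_nonneg[of M UNIV] unfolding c_def by (simp add: less_le)
    have real: "real_distribution (density K (\<lambda>_. ennreal c))"
      if "finite_measure K" "sets K = sets borel" "measure K UNIV = measure M UNIV" for K :: "real measure"
    proof -
      interpret K: finite_measure K by fact
      have sK: "space K = UNIV" using sets_eq_imp_space_eq[OF that(2)] by simp
      have "emeasure (density K (\<lambda>_. ennreal c)) (space K) = ennreal c * emeasure K UNIV"
        using that(2) sK by (simp add: emeasure_density_const)
      also have "\<dots> = 1" using c False that(3)
        by (simp add: K.emeasure_eq_measure ennreal_mult''[symmetric] c_def)
      finally show ?thesis using that(2) by (intro real_distribution.intro prob_spaceI real_distribution_axioms.intro) auto
    qed
    have ch: "char (density K (\<lambda>_. ennreal c)) t = c *\<^sub>R char K t" if "sets K = sets borel" for K t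
      unfolding char_def using that c
      by (subst integral_density) (auto simp: measurable_cong_sets[OF that refl])
    have "density M (\<lambda>_. ennreal c) = density N (\<lambda>_. ennreal c)"
      by (intro Levy_uniqueness real M N ext) (auto simp: ch M N char meas)
    then show ?thesis by (rule density_const_cancel[OF c]) (simp add: M N)
  qed
qed

lemma cos_integrable:
  assumes "finite_measure M" "f \<in> borel_measurable M" "A \<in> sets M"
  shows "integrable M (\<lambda>x. indicator A x * cos (f x) :: real)"
  using assms by (intro finite_measure.integrable_const_bound[of M _ 1]) (auto simp: indicator_def)

text \<open>Finite-dimensional cylinders, given inductively so that adding one constraint is exactly
  the induction step of the uniqueness argument.\<close>

inductive_set dual_cylinders :: "'w::{real_vector, topological_space} set set" where
  UNIV: "UNIV \<in> dual_cylinders"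
| Int: "C \<in> dual_cylinders \<Longrightarrow> f \<in> topological_dual \<Longrightarrow> B \<in> sets borel \<Longrightarrow> C \<inter> f -` B \<in> dual_cylinders"

lemma Int_stable_dual_cylinders: "Int_stable dual_cylinders"
proof (rule Int_stableI)
  fix C C' :: "'w::{real_vector, topological_space} set"
  assume C: "C \<in> dual_cylinders" and "C' \<in> dual_cylinders"
  from this(2) show "C \<inter> C' \<in> dual_cylinders"
    by induction (auto simp: C Int_assoc[symmetric] intro: dual_cylinders.Int)
qed

text \<open>By \<open>measurable_dualI\<close> the identity is measurable from the generated
  sigma-algebra to the Borel one, because the preimage of a Borel set under one functional is a
  cylinder.\<close>

lemma sets_borel_dual_cylinders:
  "sets (borel :: 'w::{frechet_space, second_countable_topology} measure) = sigma_sets UNIV dual_cylinders"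
proof (intro equalityI subsetI)
  let ?S = "sigma UNIV (dual_cylinders :: 'w set set)"
  have "(\<lambda>x. x) \<in> borel_measurable ?S"
  proof (rule measurable_dualI)
    fix e :: "'w \<Rightarrow> real" assume e: "e \<in> topological_dual"
    show "e \<in> borel_measurable ?S"
    proof (rule measurableI)
      fix B :: "real set" assume "B \<in> sets borel"
      then have "UNIV \<inter> e -` B \<in> dual_cylinders" by (intro dual_cylinders.intros e)
      then show "e -` B \<inter> space ?S \<in> sets ?S" by auto
    qed simp
  qed
  fix A :: "'w set" assume "A \<in> sets borel"
  then have "A \<in> sets ?S" using measurable_sets[OF \<open>(\<lambda>x. x) \<in> borel_measurable ?S\<close>] by fastforce
  then show "A \<in> sigma_sets UNIV dual_cylinders" by simp
next
  fix A :: "'w set"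
  have borel: "C \<in> sets borel" if "C \<in> dual_cylinders" for C :: "'w set"
    using that by induction (auto dest!: topological_dual_measurable simp: measurable_sets_borel)
  assume "A \<in> sigma_sets UNIV dual_cylinders"
  then show "A \<in> sets borel"
    by induction (auto intro: borel)
qed

text \<open>A Cramer--Wold argument: the one-dimensional uniqueness theorem is applied successively to
  the images of the measures with densities \<open>1\<^sub>C (1 + cos (e + c))\<close>, the constraints being added
  to the cylinder \<open>C\<close> one at a time.\<close>

lemma measure_eqI_dual:
  fixes M N :: "'w::{frechet_space, second_countable_topology} measure"
  assumes M: "finite_measure M" "sets M = sets borel" and N: "finite_measure N" "sets N = sets borel"
    and eq: "\<And>e c. e \<in> topological_dual \<Longrightarrow> (\<integral>x. cos (e x + c) \<partial>M) = (\<integral>x. cos (e x + c) \<partial>N)"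
  shows "M = N"
proof -
  interpret M: finite_measure M by fact
  interpret N: finite_measure N by fact
  \<comment> \<open>The invariant covers all e and c at once, because the step for e uses e + t f
    and e - t f with other phases.\<close>
  define P where "P C \<longleftrightarrow> C \<in> sets borel \<and> (\<forall>e\<in>topological_dual. \<forall>c.
    (\<integral>x. indicator C x * cos (e x + c) \<partial>M) = (\<integral>x. indicator C x * cos (e x + c) \<partial>N))" for C
  have step: "P (C \<inter> f -` B)" if P: "P C" and f: "f \<in> topological_dual" and B: "B \<in> sets borel" for C f B
  proof -
    have [measurable]: "C \<in> sets borel" using P by (simp add: P_def)
    note [measurable] = topological_dual_measurable[OF f] B
    have PI: "(\<integral>x. indicator C x * cos (e x + c) \<partial>M) = (\<integral>x. indicator C x * cos (e x + c) \<partial>N)"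
      if "e \<in> topological_dual" for e c using P that by (simp add: P_def)
    define I where "I e c K = (\<integral>x. indicator (C \<inter> f -` B) x * cos (e x + c) \<partial>K)" for e :: "'w \<Rightarrow> real" and c :: real and K :: "'w measure"
    have sum_eq: "I e c M + I (\<lambda>x. 0) 0 M = I e c N + I (\<lambda>x. 0) 0 N"
      if e: "e \<in> topological_dual" for e c
    proof -
      note [measurable] = topological_dual_measurable[OF e]
      \<comment> \<open>Adding 1 makes the density nonnegative. The extra term
        \<open>I (\<lambda>x. 0) 0\<close> that this produces is removed afterwards by the case e =
        0, c = 0, where it coincides with the main term.\<close>
      define g where "g x = indicator C x * (1 + cos (e x + c))" for x
      have g[measurable]: "g \<in> borel_measurable borel" unfolding g_def by measurable
      have "0 \<le> 1 + cos (e x + c)" "1 + cos (e x + c) \<le> 2" for x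
        using cos_ge_minus_one[of "e x + c"] cos_le_one[of "e x + c"] by linarith+
      then have g0: "0 \<le> g x" and g2: "g x \<le> 2" for x
        by (simp_all add: g_def indicator_def)
      define Q where "Q K = distr (density K (\<lambda>x. ennreal (g x))) borel f" for K :: "'w measure"
      have Qint: "(\<integral>y. h y \<partial>Q K) = (\<integral>x. g x *\<^sub>R h (f x) \<partial>K)" and Qfin: "finite_measure (Q K)"
        if K: "finite_measure K" "sets K = sets borel" and h[measurable]: "h \<in> borel_measurable borel"
        for K and h :: "real \<Rightarrow> 'b::{banach, second_countable_topology}"
      proof -
        interpret K: finite_measure K by fact
        note [measurable_cong] = K(2)
        show "(\<integral>y. h y \<partial>Q K) = (\<integral>x. g x *\<^sub>R h (f x) \<partial>K)" unfolding Q_def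
          by (subst integral_distr) (auto simp: integral_density g0)
        have "(\<integral>\<^sup>+x. ennreal (g x) \<partial>K) \<le> (\<integral>\<^sup>+x. 2 \<partial>K)"
          using g2 by (intro nn_integral_mono) (auto simp: ennreal_le_iff2 simp flip: ennreal_numeral)
        also have "\<dots> < \<infinity>" by (simp add: ennreal_mult_less_top K.emeasure_eq_measure)
        finally have "emeasure (density K (\<lambda>x. ennreal (g x))) (space K) \<noteq> \<infinity>"
          by (simp add: emeasure_density cong: nn_integral_cong)
        then have "finite_measure (density K (\<lambda>x. ennreal (g x)))" by (intro finite_measureI) simp
        then show "finite_measure (Q K)" unfolding Q_def by (rule finite_measure.finite_measure_distr) measurable
      qed
      \<comment> \<open>The product formula for cosines leaves only the functionals t f, e + t f and
        e - t f, to which the invariant for C applies.\<close>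
      have trig: "(\<integral>x. g x * cos (t * f x + s) \<partial>K) = (\<integral>x. indicator C x * cos (t * f x + s) \<partial>K)
          + ((\<integral>x. indicator C x * cos ((e x + t * f x) + (c + s)) \<partial>K)
           + (\<integral>x. indicator C x * cos ((e x - t * f x) + (c - s)) \<partial>K)) / 2"
        if K: "finite_measure K" "sets K = sets borel" for K t s
      proof -
        note [measurable_cong] = K(2)
        have "g x * cos (t * f x + s) = indicator C x * cos (t * f x + s)
          + (indicator C x * cos ((e x + t * f x) + (c + s))
           + indicator C x * cos ((e x - t * f x) + (c - s))) / 2" for x
          using cos_times_cos[of "e x + c" "t * f x + s"]
          by (simp add: g_def algebra_simps add_divide_distrib)
        moreover have "integrable K (\<lambda>x. indicator C x * cos (t * f x + s) :: real)"
          "integrable K (\<lambda>x. indicator C x * cos ((e x + t * f x) + (c + s)) :: real)"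
          "integrable K (\<lambda>x. indicator C x * cos ((e x - t * f x) + (c - s)) :: real)"
          by (intro cos_integrable K(1); measurable)+
        ultimately show ?thesis by simp
      qed
      have trig_eq: "(\<integral>x. g x * cos (t * f x + s) \<partial>M) = (\<integral>x. g x * cos (t * f x + s) \<partial>N)" for t s
        unfolding trig[OF M] trig[OF N]
        using PI[OF topological_dual_scale[OF f], of t s]
          PI[OF topological_dual_add[OF e topological_dual_scale[OF f]], of t "c + s"]
          PI[OF topological_dual_diff[OF e topological_dual_scale[OF f]], of t "c - s"] by simp
      \<comment> \<open>The sine in the imaginary part is a cosine with phase - pi / 2; this is why
        arbitrary phases are carried along.\<close>
      have char: "char (Q K) t = complex_of_real (\<integral>x. g x * cos (t * f x + 0) \<partial>K)
          + \<i> * complex_of_real (\<integral>x. g x * cos (t * f x + (- pi / 2)) \<partial>K)"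
        if K: "finite_measure K" "sets K = sets borel" for K t
      proof -
        interpret K: finite_measure K by fact
        note [measurable_cong] = K(2)
        have bnd: "\<bar>g x * cos y\<bar> \<le> 2" for x y
          using mult_mono[of "g x" 2 "\<bar>cos y\<bar>" 1] g0[of x] g2[of x] by (simp add: abs_mult)
        have int: "integrable K (\<lambda>x. g x * cos (t * f x + s))" for s
          by (intro K.integrable_const_bound[of _ 2]) (auto simp: bnd)
        have "char (Q K) t = (\<integral>x. g x *\<^sub>R iexp (t * f x) \<partial>K)" unfolding char_def by (rule Qint[OF K]) measurable
        also have "\<dots> = (\<integral>x. complex_of_real (g x * cos (t * f x + 0))
            + \<i> * complex_of_real (g x * cos (t * f x + (- pi / 2))) \<partial>K)"
          by (intro Bochner_Integration.integral_cong refl)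
            (simp add: complex_eq_iff scaleR_conv_of_real Re_exp Im_exp cos_diff)
        also have "\<dots> = complex_of_real (\<integral>x. g x * cos (t * f x + 0) \<partial>K)
          + \<i> * complex_of_real (\<integral>x. g x * cos (t * f x + (- pi / 2)) \<partial>K)"
          by (subst Bochner_Integration.integral_add)
            (simp_all only: integral_mult_right_zero integral_complex_of_real
              integrable_mult_right integrable_of_real int)
        finally show ?thesis .
      qed
      have "Q M = Q N"
      proof (rule finite_measure_eqI_char)
        show "finite_measure (Q M)" "finite_measure (Q N)"
          using Qfin[OF M borel_measurable_const[of "0::real"]] Qfin[OF N borel_measurable_const[of "0::real"]] .
        show "char (Q M) = char (Q N)" by (intro ext) (simp only: char[OF M] char[OF N] trig_eq)
      qed (simp_all add: Q_def)
      have "(\<integral>x. g x * indicator B (f x) \<partial>K) = I e c K + I (\<lambda>x. 0) 0 K"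
        if K: "finite_measure K" "sets K = sets borel" for K
      proof -
        note [measurable_cong] = K(2)
        have "C \<inter> f -` B \<in> sets borel" by measurable
        then have "integrable K (\<lambda>x. indicator (C \<inter> f -` B) x * cos (e x + c) :: real)"
          "integrable K (\<lambda>x. indicator (C \<inter> f -` B) x * cos (0 + 0) :: real)"
          using K(2) by (intro cos_integrable K(1); simp)+
        then have "I e c K + I (\<lambda>x. 0) 0 K =
            (\<integral>x. indicator (C \<inter> f -` B) x * cos (e x + c) + indicator (C \<inter> f -` B) x * cos (0 + 0) \<partial>K)"
          unfolding I_def by (subst Bochner_Integration.integral_add) auto
        also have "\<dots> = (\<integral>x. g x * indicator B (f x) \<partial>K)"
          by (intro Bochner_Integration.integral_cong refl) (auto simp: g_def indicator_def)
        finally show ?thesis ..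
      qed
      moreover have "(\<integral>x. g x * indicator B (f x) \<partial>M) = (\<integral>x. g x * indicator B (f x) \<partial>N)"
        using Qint[OF M, of "indicator B :: real \<Rightarrow> real"] Qint[OF N, of "indicator B :: real \<Rightarrow> real"] \<open>Q M = Q N\<close> by simp
      ultimately show ?thesis using M N by simp
    qed
    have "I (\<lambda>x. 0) 0 M = I (\<lambda>x. 0) 0 N"
      using sum_eq[OF topological_dual_zero, of 0] by simp
    then show ?thesis using sum_eq by (simp add: P_def I_def)
  qed
  have cyl: "P C" if "C \<in> dual_cylinders" for C
    using that by induction (use step in \<open>auto simp: P_def[of UNIV] eq\<close>)
  have em: "emeasure M C = emeasure N C" if "C \<in> dual_cylinders" for C
  proof -
    note C = cyl[OF that, unfolded P_def]
    have "C \<in> sets borel" using C by blast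
    moreover have "(\<integral>x. indicator C x * cos (0 + 0 :: real) \<partial>M) = (\<integral>x. indicator C x * cos (0 + 0) \<partial>N)"
      using bspec[OF conjunct2[OF C] topological_dual_zero] by (rule spec)
    ultimately show ?thesis using M(2) N(2) by (simp add: M.emeasure_eq_measure N.emeasure_eq_measure)
  qed
  show ?thesis
  proof (rule measure_eqI_generator_eq[OF Int_stable_dual_cylinders _ em])
    show "range (\<lambda>_::nat. UNIV) \<subseteq> (dual_cylinders :: 'w set set)" by (auto intro: dual_cylinders.UNIV)
  qed (auto simp: M N sets_borel_dual_cylinders)
qed

section \<open>Quasi-invariance\<close>

lemma std_normal_integral_cos:
  "(\<integral>\<xi>. cos (s * \<xi> + d) \<partial>std_normal_distribution) = cos d * exp (- s\<^sup>2 / 2)"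
proof -
  interpret real_distribution std_normal_distribution by (rule real_dist_normal_dist)
  have int: "complex_integrable std_normal_distribution (\<lambda>\<xi>. iexp (s * \<xi>))"
    by (intro integrable_const_bound[of _ 1]) auto
  have "(\<integral>\<xi>. cos (s * \<xi> + d) \<partial>std_normal_distribution)
      = (\<integral>\<xi>. Re (iexp d * iexp (s * \<xi>)) \<partial>std_normal_distribution)"
    by (intro Bochner_Integration.integral_cong refl) (simp add: Re_exp Im_exp cos_add algebra_simps)
  also have "\<dots> = Re (iexp d * char std_normal_distribution s)"
    using int by (subst integral_Re) (auto simp: char_def)
  also have "\<dots> = cos d * exp (- s\<^sup>2 / 2)"
    unfolding char_std_normal_distribution by (simp add: Re_exp)
  finally show ?thesis .
qed

text \<open>Positivity of the normal density allows passing to Lebesgue measure, which is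
  translation invariant.\<close>

lemma std_normal_AE_iff:
  assumes "Measurable.pred borel P"
  shows "(AE \<xi> in std_normal_distribution. P \<xi>) \<longleftrightarrow> (AE \<xi> in lborel. P \<xi>)"
  by (subst AE_density) (auto simp: normal_density_pos)

lemma gaussian_law_eq_distr:
  assumes "0 \<le> \<sigma>"
  shows "gaussian_law \<sigma> = distr std_normal_distribution borel (\<lambda>\<xi>. \<sigma> * \<xi>)"
proof (cases "\<sigma> = 0")
  case True
  interpret prob_space std_normal_distribution by (rule prob_space_normal_density) simp
  show ?thesis using True by (simp add: gaussian_law_def distr_const)
next
  case False
  interpret prob_space std_normal_distribution by (rule prob_space_normal_density) simp
  have "distributed std_normal_distribution lborel (\<lambda>x. x) (normal_density 0 1)"
    by (auto simp: distributed_def distr_id2)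
  from normal_density_affine[OF this, of \<sigma> 0] False assms
  have "distributed std_normal_distribution lborel (\<lambda>x. \<sigma> * x) (normal_density 0 \<sigma>)" by simp
  then have "distr std_normal_distribution lborel (\<lambda>x. \<sigma> * x) = density lborel (normal_density 0 \<sigma>)"
    by (simp add: distributed_def)
  moreover have "distr std_normal_distribution lborel (\<lambda>x. \<sigma> * x) = distr std_normal_distribution borel (\<lambda>x. \<sigma> * x)"
    by (intro distr_cong) auto
  ultimately show ?thesis using False by (simp add: gaussian_law_def)
qed

context abstract_wiener_space
begin

lemmas sets_\<mu>_cong [measurable_cong] = sets_\<mu>

lemma linear_j_simps: "j (x + y) = j x + j y" "j (c *\<^sub>R x) = c *\<^sub>R j x" "j (x - y) = j x - j y" "j (- x) = - j x"
  using linear_add[OF linear_j] linear_scale[OF linear_j] linear_diff[OF linear_j] linear_neg[OF linear_j]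
  by auto

lemma integral_cos:
  assumes e: "e \<in> topological_dual"
  shows "(\<integral>x. cos (e x + c) \<partial>\<mu>) = cos c * exp (- (norm (riesz_vec j e))\<^sup>2 / 2)"
proof -
  note [measurable] = topological_dual_measurable[OF e]
  have "(\<integral>x. cos (e x + c) \<partial>\<mu>) = (\<integral>y. cos (y + c) \<partial>distr \<mu> borel e)"
    by (subst integral_distr) auto
  also have "\<dots> = (\<integral>\<xi>. cos (norm (riesz_vec j e) * \<xi> + c) \<partial>std_normal_distribution)"
    unfolding gaussian_\<mu>[OF e] gaussian_law_eq_distr[OF norm_ge_zero]
    by (subst integral_distr) auto
  finally show ?thesis by (simp add: std_normal_integral_cos)
qed

section \<open>Null sets along lines in a Cameron-Martin direction\<close>

text \<open>Under the resampling map a functional e' becomes e'' + a \<xi>, where e'' = e' - a e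
  corresponds to the part of the vector of e' orthogonal to k. By Pythagoras the variances of e''
  and a \<xi> add up to that of e', and \<open>measure_eqI_dual\<close> concludes.\<close>

lemma distr_resample:
  assumes e: "e \<in> topological_dual" and unit: "norm (riesz_vec j e) = 1"
  shows "distr (\<mu> \<Otimes>\<^sub>M std_normal_distribution) borel (\<lambda>(x, \<xi>). x + (\<xi> - e x) *\<^sub>R j (riesz_vec j e)) = \<mu>"
    (is "distr ?P borel ?f = \<mu>")
proof (rule measure_eqI_dual)
  let ?N = std_normal_distribution and ?k = "riesz_vec j e"
  interpret \<mu>: prob_space \<mu> by (rule prob_\<mu>)
  interpret N: prob_space ?N by (rule prob_space_normal_density) simp
  interpret P: pair_prob_space \<mu> ?N ..
  note [measurable] = topological_dual_measurable[OF e]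
  have f[measurable]: "?f \<in> ?P \<rightarrow>\<^sub>M borel" by measurable
  show "finite_measure (distr ?P borel ?f)" by (intro P.finite_measure_distr f)
  show "finite_measure \<mu>" by (rule \<mu>.finite_measure_axioms)
  fix e' :: "'w \<Rightarrow> real" and c :: real assume e': "e' \<in> topological_dual"
  note [measurable] = topological_dual_measurable[OF e']
  define a where "a = e' (j ?k)"
  define e'' where "e'' x = e' x - a * e x" for x
  have e'': "e'' \<in> topological_dual"
    using topological_dual_diff[OF e' topological_dual_scale[OF e, of a]] unfolding e''_def .
  note [measurable] = topological_dual_measurable[OF e'']
  have riesz'': "riesz_vec j e'' = riesz_vec j e' - a *\<^sub>R ?k"
    by (rule riesz_vec_eqI[OF e'']) (simp add: e''_def riesz_vec[OF e] riesz_vec[OF e'] inner_diff_left)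
  have "inner ?k ?k = 1" using unit by (simp add: norm_eq_sqrt_inner)
  then have norm: "(norm (riesz_vec j e''))\<^sup>2 + a\<^sup>2 = (norm (riesz_vec j e'))\<^sup>2"
    unfolding riesz'' power2_norm_eq_inner
    by (simp add: inner_diff_left inner_diff_right inner_commute a_def riesz_vec[OF e'] power2_eq_square)
  have "(\<integral>x. cos (e' x + c) \<partial>distr ?P borel ?f) = (\<integral>z. cos (e' (?f z) + c) \<partial>?P)"
    by (subst integral_distr) auto
  also have "\<dots> = (\<integral>z. cos (a * snd z + (e'' (fst z) + c)) \<partial>?P)"
    by (intro Bochner_Integration.integral_cong refl)
      (auto simp: e''_def a_def linear_add[OF topological_dual_linear[OF e']]
        linear_diff[OF topological_dual_linear[OF e']]
        linear_scale[OF topological_dual_linear[OF e']] algebra_simps)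
  also have "\<dots> = (\<integral>x. (\<integral>\<xi>. cos (a * \<xi> + (e'' x + c)) \<partial>?N) \<partial>\<mu>)"
    by (subst P.integral_fst'[symmetric]) (auto intro!: P.integrable_const_bound[of _ 1])
  also have "\<dots> = (\<integral>x. cos (e'' x + c) \<partial>\<mu>) * exp (- a\<^sup>2 / 2)"
    by (simp add: std_normal_integral_cos)
  also have "\<dots> = cos c * exp (- a\<^sup>2 / 2 + - (norm (riesz_vec j e''))\<^sup>2 / 2)"
    unfolding integral_cos[OF e''] exp_add by simp
  also have "- a\<^sup>2 / 2 + - (norm (riesz_vec j e''))\<^sup>2 / 2 = - (norm (riesz_vec j e'))\<^sup>2 / 2"
    using norm by (simp add: field_simps)
  also have "cos c * exp (- (norm (riesz_vec j e'))\<^sup>2 / 2) = (\<integral>x. cos (e' x + c) \<partial>\<mu>)"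
    by (simp add: integral_cos[OF e'])
  finally show "(\<integral>x. cos (e' x + c) \<partial>distr ?P borel ?f) = (\<integral>x. cos (e' x + c) \<partial>\<mu>)" .
qed (simp_all add: sets_\<mu>)

text \<open>Fubini for the representation in \<open>distr_resample\<close>; on each line the normal
  law is exchanged for Lebesgue measure, which has the same null sets.\<close>

lemma AE_iff_lines:
  assumes e: "e \<in> topological_dual" and unit: "norm (riesz_vec j e) = 1"
    and P[measurable]: "Measurable.pred borel P"
  shows "(AE y in \<mu>. P y) \<longleftrightarrow> (AE x in \<mu>. AE \<xi> in lborel. P (x + (\<xi> - e x) *\<^sub>R j (riesz_vec j e)))"
proof -
  let ?N = std_normal_distribution and ?k = "riesz_vec j e"
  interpret \<mu>: prob_space \<mu> by (rule prob_\<mu>)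
  interpret N: prob_space ?N by (rule prob_space_normal_density) simp
  interpret P: pair_prob_space \<mu> ?N ..
  note [measurable] = topological_dual_measurable[OF e]
  have "(AE y in \<mu>. P y) \<longleftrightarrow> (AE z in \<mu> \<Otimes>\<^sub>M ?N. P (fst z + (snd z - e (fst z)) *\<^sub>R j ?k))"
    by (subst distr_resample[OF e unit, symmetric], subst AE_distr_iff) (auto simp: case_prod_beta)
  also have "\<dots> \<longleftrightarrow> (AE x in \<mu>. AE \<xi> in ?N. P (x + (\<xi> - e x) *\<^sub>R j ?k))"
  proof (rule P.AE_pair_iff[symmetric])
    have "Measurable.pred (\<mu> \<Otimes>\<^sub>M ?N) (\<lambda>z. P (fst z + (snd z - e (fst z)) *\<^sub>R j ?k))" by measurable
    then show "{z \<in> space (\<mu> \<Otimes>\<^sub>M ?N). P (fst z + (snd z - e (fst z)) *\<^sub>R j ?k)} \<in> sets (\<mu> \<Otimes>\<^sub>M ?N)"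
      by (simp only: pred_def)
  qed
  also have "\<dots> \<longleftrightarrow> (AE x in \<mu>. AE \<xi> in lborel. P (x + (\<xi> - e x) *\<^sub>R j ?k))"
    by (subst std_normal_AE_iff) auto
  finally show ?thesis .
qed

text \<open>Adding t k moves the parameter \<xi> of each line by t, which preserves Lebesgue
  measure. This is the qualitative part of the Cameron-Martin theorem.\<close>

lemma AE_shift:
  assumes e: "e \<in> topological_dual" and unit: "norm (riesz_vec j e) = 1"
    and P[measurable]: "Measurable.pred borel P" and ae: "AE y in \<mu>. P y"
  shows "AE y in \<mu>. P (y + t *\<^sub>R j (riesz_vec j e))"
proof -
  let ?k = "riesz_vec j e"
  note [measurable] = topological_dual_measurable[OF e]
  have "AE x in \<mu>. AE \<xi> in lborel. P (x + (\<xi> - e x) *\<^sub>R j ?k)"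
    using ae AE_iff_lines[OF e unit P] by simp
  moreover have "AE \<xi> in lborel. P (x + (\<xi> - e x) *\<^sub>R j ?k + t *\<^sub>R j ?k)"
    if "AE \<xi> in lborel. P (x + (\<xi> - e x) *\<^sub>R j ?k)" for x
  proof -
    have "AE \<xi> in distr lborel borel ((+) t). P (x + (\<xi> - e x) *\<^sub>R j ?k)"
      unfolding lborel_distr_plus by (rule that)
    then have "AE \<xi> in lborel. P (x + (t + \<xi> - e x) *\<^sub>R j ?k)"
      by (subst (asm) AE_distr_iff) auto
    then show ?thesis by (simp add: algebra_simps)
  qed
  ultimately show ?thesis by (subst AE_iff_lines[OF e unit]) auto
qed

text \<open>Otherwise the translates of \<open>A\<close> by \<open>t k\<close>, \<open>0 < t < \<epsilon>\<close>, would be uncountably many almost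
  disjoint sets of positive measure.\<close>

lemma small_translate_meets:
  assumes e: "e \<in> topological_dual" and unit: "norm (riesz_vec j e) = 1"
    and A[measurable]: "A \<in> sets borel" and pos: "\<not> (AE y in \<mu>. y \<notin> A)" and \<epsilon>: "0 < \<epsilon>"
  shows "\<exists>t. 0 < t \<and> t < \<epsilon> \<and> \<not> (AE y in \<mu>. \<not> (y \<in> A \<and> y + t *\<^sub>R j (riesz_vec j e) \<in> A))"
proof (rule ccontr)
  let ?k = "j (riesz_vec j e)"
  interpret \<mu>: prob_space \<mu> by (rule prob_\<mu>)
  assume "\<not> ?thesis"
  then have null: "AE y in \<mu>. \<not> (y \<in> A \<and> y + t *\<^sub>R ?k \<in> A)" if "0 < t" "t < \<epsilon>" for t
    using that by blast
  define B where "B t = {y. y + t *\<^sub>R ?k \<in> A}" for t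
  have B[measurable]: "B t \<in> sets borel" for t
  proof -
    have "Measurable.pred borel (\<lambda>y. y + t *\<^sub>R ?k \<in> A)" by measurable
    then show ?thesis by (simp add: B_def pred_def)
  qed
  have Bmeas: "B t \<in> sets \<mu>" for t by (simp add: sets_\<mu>)
  have disj1: "AE y in \<mu>. y \<notin> B s \<or> y \<notin> B t" if "s < t" "0 < s" "t < \<epsilon>" for s t
  proof -
    have "AE y in \<mu>. \<not> (y \<in> A \<and> y + (t - s) *\<^sub>R ?k \<in> A)" using that by (intro null) auto
    from AE_shift[OF e unit _ this, of s] show ?thesis
      by (simp add: B_def algebra_simps)
  qed
  have disj: "AE y in \<mu>. y \<notin> B s \<or> y \<notin> B t" if "s \<noteq> t" "s \<in> {0<..<\<epsilon>}" "t \<in> {0<..<\<epsilon>}" for s t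
  proof (cases "s < t")
    case True
    then show ?thesis using that by (intro disj1) auto
  next
    case False
    then have "AE y in \<mu>. y \<notin> B t \<or> y \<notin> B s" using that by (intro disj1) auto
    then show ?thesis by eventually_elim blast
  qed
  have Bpos: "0 < measure \<mu> (B t)" for t
  proof (rule ccontr)
    assume "\<not> 0 < measure \<mu> (B t)"
    then have "emeasure \<mu> (B t) = 0" by (simp add: \<mu>.emeasure_eq_measure not_less measure_le_0_iff)
    then have "AE y in \<mu>. y \<notin> B t" using Bmeas by (intro AE_not_in) (auto simp: null_sets_def)
    from AE_shift[OF e unit _ this, of "- t"] have "AE y in \<mu>. y \<notin> A" by (simp add: B_def)
    then show False using pos by simp
  qed
  \<comment> \<open>Pigeonhole: countably many sets \<open>L n\<close> cover an uncountable
    interval, so one is infinite; n + 1 of its almost disjoint sets \<open>B t\<close> would have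
    total measure above 1.\<close>
  define L where "L n = {t \<in> {0<..<\<epsilon>}. 1 / real (Suc n) < measure \<mu> (B t)}" for n
  have "{0<..<\<epsilon>} \<subseteq> (\<Union>n. L n)"
  proof
    fix t assume "t \<in> {0<..<\<epsilon>}"
    moreover obtain n where "inverse (real (Suc n)) < measure \<mu> (B t)"
      using reals_Archimedean[OF Bpos] by blast
    ultimately show "t \<in> (\<Union>n. L n)" by (auto simp: L_def inverse_eq_divide)
  qed
  then have "\<exists>n. infinite (L n)"
    using uncountable_open_interval[of 0 \<epsilon>] \<epsilon> countable_subset[of "{0<..<\<epsilon>}" "\<Union>n. L n"]
    by (auto intro: countable_finite)
  then obtain n where "infinite (L n)" by blast
  then obtain F where F: "F \<subseteq> L n" "finite F" "card F = Suc n" by (meson infinite_arbitrarily_large)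
  have "measure \<mu> (\<Union>t\<in>F. B t) = (\<Sum>t\<in>F. measure \<mu> (B t))"
    using F disj Bmeas
    by (intro measure_UNION_AE) (auto simp: pairwise_def L_def \<mu>.fmeasurable_eq_sets)
  moreover have "(\<Sum>t\<in>F. 1 / real (Suc n)) < (\<Sum>t\<in>F. measure \<mu> (B t))"
    using F by (intro sum_strict_mono) (auto simp: L_def)
  moreover have "(\<Sum>t\<in>F. 1 / real (Suc n)) = 1" using F by simp
  ultimately show False using \<mu>.prob_le_1[of "\<Union>t\<in>F. B t"] by linarith
qed

end

section \<open>Exchanging targets\<close>

lemma absolutely_continuousI_AE:
  assumes "\<And>A. A \<in> sets M \<Longrightarrow> AE x in M. x \<notin> A \<Longrightarrow> AE x in N. x \<notin> A" "sets N = sets M"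
  shows "absolutely_continuous M N"
  unfolding absolutely_continuous_def
proof
  fix A assume A: "A \<in> null_sets M"
  then have "AE x in N. x \<notin> A" using assms(1)[of A] AE_not_in[OF A] by auto
  then show "A \<in> null_sets N" using A assms(2) by (subst AE_iff_null_sets) auto
qed

text \<open>The common part has the minimum of the two densities as its density. Dividing by either
  density writes it as a weight of at most 1 on the corresponding measure.\<close>

lemma common_part_weights:
  fixes M :: "'a measure"
  assumes "sigma_finite_measure M"
    and N1: "finite_measure N1" "absolutely_continuous M N1" "sets N1 = sets M"
    and N2: "finite_measure N2" "absolutely_continuous M N2" "sets N2 = sets M"
    and overlap: "\<not> (AE y in M. \<not> (0 < RN_deriv M N1 y \<and> 0 < RN_deriv M N2 y))"
  obtains w1 w2 :: "'a \<Rightarrow> real"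
  where "w1 \<in> borel_measurable M" "w2 \<in> borel_measurable M"
    and "\<And>y. 0 \<le> w1 y" "\<And>y. w1 y \<le> 1" "\<And>y. 0 \<le> w2 y" "\<And>y. w2 y \<le> 1"
    and "\<And>h. h \<in> borel_measurable M \<Longrightarrow> (\<integral>\<^sup>+y. ennreal (w1 y) * h y \<partial>N1) = (\<integral>\<^sup>+y. ennreal (w2 y) * h y \<partial>N2)"
    and "0 < (\<integral>\<^sup>+y. ennreal (w1 y) \<partial>N1)"
proof
  interpret sigma_finite_measure M by fact
  interpret N1: finite_measure N1 by fact
  interpret N2: finite_measure N2 by fact
  define f where "f K y = enn2real (RN_deriv M K y)" for K y
  have f[measurable]: "f K \<in> borel_measurable M" for K unfolding f_def by measurable
  have f0: "0 \<le> f K y" for K y by (simp add: f_def)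
  \<comment> \<open>Where \<open>f K y\<close> is 0 the quotient is 0 by convention; the minimum is
    0 there too, so multiplying back is still correct.\<close>
  define w where "w K y = min (f N1 y) (f N2 y) / f K y" for K y
  have w[measurable]: "w K \<in> borel_measurable M" for K unfolding w_def by measurable
  have fin: "AE y in M. RN_deriv M N1 y \<noteq> \<infinity>" "AE y in M. RN_deriv M N2 y \<noteq> \<infinity>"
    using N1 N2 N1.sigma_finite_measure_axioms N2.sigma_finite_measure_axioms
    by (intro RN_deriv_finite; simp)+
  have dens: "(\<integral>\<^sup>+y. ennreal (w K y) * h y \<partial>K) = (\<integral>\<^sup>+y. ennreal (min (f N1 y) (f N2 y)) * h y \<partial>M)"
    if K: "K = N1 \<or> K = N2" and h[measurable]: "h \<in> borel_measurable M" for K h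
  proof -
    have "(\<integral>\<^sup>+y. ennreal (w K y) * h y \<partial>K) = (\<integral>\<^sup>+y. ennreal (w K y) * h y \<partial>density M (RN_deriv M K))"
      using K N1 N2 by (auto simp: density_RN_deriv)
    also have "\<dots> = (\<integral>\<^sup>+y. RN_deriv M K y * (ennreal (w K y) * h y) \<partial>M)"
      by (subst nn_integral_density) auto
    also have "\<dots> = (\<integral>\<^sup>+y. ennreal (min (f N1 y) (f N2 y)) * h y \<partial>M)"
    proof (rule nn_integral_cong_AE)
      have "AE y in M. RN_deriv M K y \<noteq> \<infinity>" using K fin by auto
      then show "AE y in M. RN_deriv M K y * (ennreal (w K y) * h y) = ennreal (min (f N1 y) (f N2 y)) * h y"
      proof eventually_elim
        case (elim y)
        have "RN_deriv M K y = ennreal (f K y)" using elim by (simp add: f_def less_top)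
        then have "RN_deriv M K y * ennreal (w K y) = ennreal (f K y * w K y)"
          by (simp add: ennreal_mult' f0)
        also have "f K y * w K y = min (f N1 y) (f N2 y)"
          using K f0[of N1 y] f0[of N2 y] by (auto simp: w_def)
        finally show ?case by (simp add: mult.assoc[symmetric])
      qed
    qed
    finally show ?thesis .
  qed
  show "w N1 \<in> borel_measurable M" "w N2 \<in> borel_measurable M" by measurable
  show "0 \<le> w N1 y" "w N1 y \<le> 1" "0 \<le> w N2 y" "w N2 y \<le> 1" for y
    using f0[of N1 y] f0[of N2 y] by (auto simp: w_def divide_le_eq_1)
  show "(\<integral>\<^sup>+y. ennreal (w N1 y) * h y \<partial>N1) = (\<integral>\<^sup>+y. ennreal (w N2 y) * h y \<partial>N2)"
    if "h \<in> borel_measurable M" for h using that by (simp add: dens)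
  show "0 < (\<integral>\<^sup>+y. ennreal (w N1 y) \<partial>N1)"
  proof (rule ccontr)
    assume "\<not> ?thesis"
    then have "(\<integral>\<^sup>+y. ennreal (min (f N1 y) (f N2 y)) \<partial>M) = 0" using dens[of N1 "\<lambda>_. 1"] by simp
    then have "AE y in M. ennreal (min (f N1 y) (f N2 y)) = 0"
      by (subst (asm) nn_integral_0_iff_AE) auto
    then have "AE y in M. \<not> (0 < RN_deriv M N1 y \<and> 0 < RN_deriv M N2 y)"
      using fin
    proof eventually_elim
      case (elim y)
      have "f N1 y = 0 \<or> f N2 y = 0" using elim(1) f0[of N1 y] f0[of N2 y]
        by (auto simp: ennreal_eq_0_iff min_def split: if_splits)
      then show ?case using elim(2,3) by (auto simp: f_def enn2real_eq_0_iff)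
    qed
    then show False using overlap by simp
  qed
qed

context abstract_wiener_space
begin

text \<open>From x, mass g1 goes to T x - v, mass g2 to T x + v, and the rest stays at T x. By
  \<open>common\<close> the first flow replaces what g2 removes; applied to translated test
  functions, it also shows that the second flow replaces what g1 removes.\<close>

lemma swap_coupling:
  fixes g1 g2 :: "'w \<Rightarrow> real"
  assumes T[measurable]: "T \<in> borel_measurable borel"
    and g[measurable]: "g1 \<in> borel_measurable borel" "g2 \<in> borel_measurable borel"
    and g0: "\<And>x. 0 \<le> g1 x" "\<And>x. 0 \<le> g2 x" "\<And>x. g1 x + g2 x \<le> 1"
    and common: "\<And>h. h \<in> borel_measurable borel \<Longrightarrow>
      (\<integral>\<^sup>+x. ennreal (g1 x) * h (T x - v) \<partial>\<mu>) = (\<integral>\<^sup>+x. ennreal (g2 x) * h (T x) \<partial>\<mu>)"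
  shows "\<exists>\<beta>\<in>couplings \<mu> (distr \<mu> borel T). \<forall>h\<in>borel_measurable (borel \<Otimes>\<^sub>M borel).
    (\<integral>\<^sup>+z. h z \<partial>\<beta>) = (\<integral>\<^sup>+x. ennreal (g1 x) * h (x, T x - v)
      + ennreal (1 - g1 x - g2 x) * h (x, T x) + ennreal (g2 x) * h (x, T x + v) \<partial>\<mu>)"
proof -
  interpret \<mu>: prob_space \<mu> by (rule prob_\<mu>)
  \<comment> \<open>The displacements - v, 0 and v are encoded by their coefficients; G gives their
    weights, with -1 as the remaining case.\<close>
  define C where "C = count_space {-1, 0, 1 :: real}"
  interpret C: sigma_finite_measure C unfolding C_def by (rule sigma_finite_measure_count_space_finite) simp
  define G where "G z = (if snd z = 0 then 1 - g1 (fst z) - g2 (fst z)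
    else if snd z = 1 then g2 (fst z) else g1 (fst z))" for z :: "'w \<times> real"
  have snd_C[measurable]: "snd \<in> borel_measurable (\<mu> \<Otimes>\<^sub>M C)"
    by (rule measurable_compose[OF measurable_snd]) (simp add: C_def)
  have [measurable]: "G \<in> borel_measurable (\<mu> \<Otimes>\<^sub>M C)" unfolding G_def by measurable
  define \<beta> where "\<beta> = distr (density (\<mu> \<Otimes>\<^sub>M C) (\<lambda>z. ennreal (G z))) (borel \<Otimes>\<^sub>M borel)
    (\<lambda>z. (fst z, T (fst z) + snd z *\<^sub>R v))"
  have int: "(\<integral>\<^sup>+z. h z \<partial>\<beta>) = (\<integral>\<^sup>+x. ennreal (g1 x) * h (x, T x - v)
      + ennreal (1 - g1 x - g2 x) * h (x, T x) + ennreal (g2 x) * h (x, T x + v) \<partial>\<mu>)"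
    if [measurable]: "h \<in> borel_measurable (borel \<Otimes>\<^sub>M borel)" for h
  proof -
    have "(\<integral>\<^sup>+z. h z \<partial>\<beta>) = (\<integral>\<^sup>+z. ennreal (G z) * h (fst z, T (fst z) + snd z *\<^sub>R v) \<partial>(\<mu> \<Otimes>\<^sub>M C))"
      unfolding \<beta>_def by (subst nn_integral_distr, measurable) (subst nn_integral_density, auto)
    also have "\<dots> = (\<integral>\<^sup>+x. \<integral>\<^sup>+i. ennreal (G (x, i)) * h (x, T x + i *\<^sub>R v) \<partial>C \<partial>\<mu>)"
      by (subst C.nn_integral_fst[symmetric]) auto
    also have "\<dots> = (\<integral>\<^sup>+x. ennreal (g1 x) * h (x, T x - v)
      + ennreal (1 - g1 x - g2 x) * h (x, T x) + ennreal (g2 x) * h (x, T x + v) \<partial>\<mu>)"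
      unfolding C_def
      by (intro nn_integral_cong) (simp add: nn_integral_count_space_finite G_def add.assoc)
    finally show ?thesis .
  qed
  have tot: "ennreal (g1 x) * c + ennreal (1 - g1 x - g2 x) * c + ennreal (g2 x) * c = c" for x c
  proof -
    have "ennreal (g1 x) + ennreal (1 - g1 x - g2 x) + ennreal (g2 x) = 1"
      using g0[of x] by (simp add: ennreal_plus[symmetric] del: ennreal_plus)
    then show ?thesis by (simp add: distrib_right[symmetric])
  qed
  have sets: "sets \<beta> = sets (borel \<Otimes>\<^sub>M borel)" by (simp add: \<beta>_def)
  note [measurable_cong] = sets
  have em: "emeasure \<beta> A = (\<integral>\<^sup>+z. indicator A z \<partial>\<beta>)" if "A \<in> sets (borel \<Otimes>\<^sub>M borel)" for A
    using that sets by simp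
  have "prob_space \<beta>"
  proof (rule prob_spaceI)
    have "emeasure \<beta> (space \<beta>) = (\<integral>\<^sup>+z. 1 \<partial>\<beta>)" by simp
    also have "\<dots> = (\<integral>\<^sup>+x. 1 \<partial>\<mu>)" by (subst int) (simp, simp only: tot)
    also have "\<dots> = 1" by (simp add: \<mu>.emeasure_space_1)
    finally show "emeasure \<beta> (space \<beta>) = 1" .
  qed
  moreover have "distr \<beta> borel fst = \<mu>"
  proof (rule measure_eqI)
    fix A assume "A \<in> sets (distr \<beta> borel fst)"
    then have A[measurable]: "A \<in> sets borel" by simp
    have "emeasure (distr \<beta> borel fst) A = (\<integral>\<^sup>+z. indicator A (fst z) \<partial>\<beta>)"
      by (subst nn_integral_distr[of fst \<beta> borel, symmetric]) auto
    also have "\<dots> = (\<integral>\<^sup>+x. indicator A x \<partial>\<mu>)" by (subst int) (auto simp: tot)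
    also have "\<dots> = emeasure \<mu> A" by (simp add: sets_\<mu>)
    finally show "emeasure (distr \<beta> borel fst) A = emeasure \<mu> A" .
  qed (simp add: sets_\<mu>)
  moreover have "distr \<beta> borel snd = distr \<mu> borel T"
  proof (rule measure_eqI)
    fix A assume "A \<in> sets (distr \<beta> borel snd)"
    then have A[measurable]: "A \<in> sets borel" by simp
    let ?I = "indicator A :: 'w \<Rightarrow> ennreal"
    have "emeasure (distr \<beta> borel snd) A = (\<integral>\<^sup>+z. indicator A (snd z) \<partial>\<beta>)"
      by (subst nn_integral_distr[of snd \<beta> borel, symmetric]) auto
    also have "\<dots> = (\<integral>\<^sup>+x. ennreal (g1 x) * ?I (T x - v) \<partial>\<mu>)
      + (\<integral>\<^sup>+x. ennreal (1 - g1 x - g2 x) * ?I (T x) \<partial>\<mu>) + (\<integral>\<^sup>+x. ennreal (g2 x) * ?I (T x + v) \<partial>\<mu>)"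
      by (subst int) (auto simp: nn_integral_add)
    also have "(\<integral>\<^sup>+x. ennreal (g1 x) * ?I (T x - v) \<partial>\<mu>) = (\<integral>\<^sup>+x. ennreal (g2 x) * ?I (T x) \<partial>\<mu>)"
      by (rule common) simp
    also have "(\<integral>\<^sup>+x. ennreal (g2 x) * ?I (T x + v) \<partial>\<mu>) = (\<integral>\<^sup>+x. ennreal (g1 x) * ?I (T x) \<partial>\<mu>)"
      by (subst common[of "\<lambda>y. ?I (y + v)", symmetric]) auto
    also have "(\<integral>\<^sup>+x. ennreal (g2 x) * ?I (T x) \<partial>\<mu>) + (\<integral>\<^sup>+x. ennreal (1 - g1 x - g2 x) * ?I (T x) \<partial>\<mu>)
        + (\<integral>\<^sup>+x. ennreal (g1 x) * ?I (T x) \<partial>\<mu>)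
      = (\<integral>\<^sup>+x. ennreal (g1 x) * ?I (T x) + ennreal (1 - g1 x - g2 x) * ?I (T x) + ennreal (g2 x) * ?I (T x) \<partial>\<mu>)"
      by (simp add: nn_integral_add ac_simps)
    also have "\<dots> = emeasure (distr \<mu> borel T) A"
      unfolding tot by (subst nn_integral_distr[of T \<mu> borel, symmetric]) auto
    finally show "emeasure (distr \<beta> borel snd) A = emeasure (distr \<mu> borel T) A" .
  qed simp
  ultimately have "\<beta> \<in> couplings \<mu> (distr \<mu> borel T)" by (simp add: couplings_def sets)
  then show ?thesis using int by blast
qed

lemma transport_cost_graph:
  assumes T[measurable]: "T \<in> borel_measurable borel"
  shows "transport_cost j (distr \<mu> (borel \<Otimes>\<^sub>M borel) (\<lambda>x. (x, T x))) = (\<integral>\<^sup>+x. cm_norm_sq j (x - T x) \<partial>\<mu>)"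
  unfolding transport_cost_def by (subst nn_integral_distr) auto

text \<open>Redirecting the mass \<open>g1\<close> from \<open>T x\<close> to \<open>T x - t k\<close> and the mass \<open>g2\<close> from \<open>T x\<close> to
  \<open>T x + t k\<close> changes the quadratic cost by at most \<open>(2 t\<^sup>2 - 2 t (b - a)) \<integral> g2\<close>.\<close>

lemma no_profitable_swap:
  fixes g1 g2 :: "'w \<Rightarrow> real"
  assumes e: "e \<in> topological_dual" and unit: "norm (riesz_vec j e) = 1"
    and T[measurable]: "T \<in> borel_measurable borel"
    and opt: "mk_solution j \<mu> (distr \<mu> borel T) (distr \<mu> (borel \<Otimes>\<^sub>M borel) (\<lambda>x. (x, T x)))"
    and fin: "(\<integral>\<^sup>+x. cm_norm_sq j (x - T x) \<partial>\<mu>) < \<infinity>"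
    and t: "0 < t" "t < b - a"
    and g[measurable]: "g1 \<in> borel_measurable borel" "g2 \<in> borel_measurable borel"
    and g0: "\<And>x. 0 \<le> g1 x" "\<And>x. 0 \<le> g2 x" "\<And>x. g1 x + g2 x \<le> 1"
    and low: "\<And>x. 0 < g1 x \<Longrightarrow> e (x - T x) < a" and high: "\<And>x. 0 < g2 x \<Longrightarrow> b < e (x - T x)"
    and common: "\<And>h. h \<in> borel_measurable borel \<Longrightarrow>
      (\<integral>\<^sup>+x. ennreal (g1 x) * h (T x - t *\<^sub>R j (riesz_vec j e)) \<partial>\<mu>) = (\<integral>\<^sup>+x. ennreal (g2 x) * h (T x) \<partial>\<mu>)"
  shows "(\<integral>\<^sup>+x. ennreal (g2 x) \<partial>\<mu>) = 0"
proof -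
  interpret \<mu>: prob_space \<mu> by (rule prob_\<mu>)
  let ?k = "riesz_vec j e"
  obtain \<beta> where \<beta>: "\<beta> \<in> couplings \<mu> (distr \<mu> borel T)"
    and int: "\<And>h. h \<in> borel_measurable (borel \<Otimes>\<^sub>M borel) \<Longrightarrow> (\<integral>\<^sup>+z. h z \<partial>\<beta>) =
      (\<integral>\<^sup>+x. ennreal (g1 x) * h (x, T x - t *\<^sub>R j ?k)
      + ennreal (1 - g1 x - g2 x) * h (x, T x) + ennreal (g2 x) * h (x, T x + t *\<^sub>R j ?k) \<partial>\<mu>)"
    using swap_coupling[OF T g g0 common] by blast
  define N where "N x = enn2real (cm_norm_sq j (x - T x))" for x
  have [measurable]: "N \<in> borel_measurable borel" unfolding N_def by measurable
  have ae: "AE x in \<mu>. cm_norm_sq j (x - T x) \<noteq> \<infinity>"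
    using fin by (intro nn_integral_PInf_AE) auto
  have costN: "(\<integral>\<^sup>+x. cm_norm_sq j (x - T x) \<partial>\<mu>) = (\<integral>\<^sup>+x. ennreal (N x) \<partial>\<mu>)"
    by (rule nn_integral_cong_AE) (use ae in eventually_elim, simp add: N_def less_top)
  have N0: "0 \<le> N x" for x by (simp add: N_def)
  have intN: "integrable \<mu> N" using fin N0 unfolding costN by (intro integrableI_nonneg) auto
  have g1: "g1 x \<le> 1" and g2: "g2 x \<le> 1" for x using g0[of x] by linarith+
  have intg: "integrable \<mu> g1" "integrable \<mu> g2"
    using g0 g1 g2 by (auto intro!: \<mu>.integrable_const_bound[of _ 1])
  \<comment> \<open>Expands |h + t k|^2 and |h - t k|^2 for x - T x = j h, with (k, h) = e (x - T x)
    replaced by a where g1 is positive and by b where g2 is positive; the terms |h|^2 recombine to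
    \<open>N x\<close>.\<close>
  define R where "R x = N x + (t\<^sup>2 + 2 * t * a) * g1 x + (t\<^sup>2 - 2 * t * b) * g2 x" for x
  have bound: "AE x in \<mu>. ennreal (g1 x) * cm_norm_sq j (x - (T x - t *\<^sub>R j ?k))
      + ennreal (1 - g1 x - g2 x) * cm_norm_sq j (x - T x)
      + ennreal (g2 x) * cm_norm_sq j (x - (T x + t *\<^sub>R j ?k)) \<le> ennreal (R x) \<and> 0 \<le> R x"
    using ae
  proof eventually_elim
    case (elim x)
    then obtain h where h: "x - T x = j h" using cm_norm_sq_finite[of "x - T x"] by (auto simp: less_top)
    have "x - (T x - t *\<^sub>R j ?k) = j h + t *\<^sub>R j ?k" using h by (metis diff_diff_eq2 add_diff_eq diff_add_eq)
    then have p: "x - (T x - t *\<^sub>R j ?k) = j (h + t *\<^sub>R ?k)" by (simp add: linear_j_simps)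
    have "x - (T x + t *\<^sub>R j ?k) = j h - t *\<^sub>R j ?k" using h by (metis diff_diff_eq)
    then have m: "x - (T x + t *\<^sub>R j ?k) = j (h - t *\<^sub>R ?k)" by (simp add: linear_j_simps)
    have eh: "e (x - T x) = inner ?k h" using riesz_vec[OF e] h by simp
    have kk: "inner ?k ?k = 1" using unit by (simp add: norm_eq_sqrt_inner)
    have np: "(norm (h + t *\<^sub>R ?k))\<^sup>2 = (norm h)\<^sup>2 + 2 * t * inner ?k h + t\<^sup>2"
      and nm: "(norm (h - t *\<^sub>R ?k))\<^sup>2 = (norm h)\<^sup>2 - 2 * t * inner ?k h + t\<^sup>2"
      unfolding power2_norm_eq_inner using kk
      by (simp_all add: inner_add_left inner_add_right inner_diff_left inner_diff_right inner_commute power2_eq_square)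
    have Nx: "N x = (norm h)\<^sup>2" by (simp add: N_def h)
    have "g1 x * (norm (h + t *\<^sub>R ?k))\<^sup>2 \<le> g1 x * ((norm h)\<^sup>2 + 2 * t * a + t\<^sup>2)"
    proof (cases "0 < g1 x")
      case True
      then have "2 * t * inner ?k h \<le> 2 * t * a" using low[OF True] t eh by simp
      then show ?thesis using True unfolding np by (intro mult_left_mono) auto
    next
      case False
      then show ?thesis using g0(1)[of x] by simp
    qed
    moreover have "g2 x * (norm (h - t *\<^sub>R ?k))\<^sup>2 \<le> g2 x * ((norm h)\<^sup>2 - 2 * t * b + t\<^sup>2)"
    proof (cases "0 < g2 x")
      case True
      then have "2 * t * b \<le> 2 * t * inner ?k h" using high[OF True] t eh by simp
      then show ?thesis using True unfolding nm by (intro mult_left_mono) auto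
    next
      case False
      then show ?thesis using g0(2)[of x] by simp
    qed
    moreover have "R x = g1 x * ((norm h)\<^sup>2 + 2 * t * a + t\<^sup>2) + (1 - g1 x - g2 x) * (norm h)\<^sup>2
        + g2 x * ((norm h)\<^sup>2 - 2 * t * b + t\<^sup>2)"
      by (simp add: R_def Nx algebra_simps)
    ultimately have le: "g1 x * (norm (h + t *\<^sub>R ?k))\<^sup>2 + (1 - g1 x - g2 x) * (norm h)\<^sup>2
        + g2 x * (norm (h - t *\<^sub>R ?k))\<^sup>2 \<le> R x" by linarith
    have pos: "0 \<le> 1 - g1 x - g2 x" using g0[of x] by simp
    have "ennreal (g1 x) * cm_norm_sq j (x - (T x - t *\<^sub>R j ?k))
      + ennreal (1 - g1 x - g2 x) * cm_norm_sq j (x - T x)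
      + ennreal (g2 x) * cm_norm_sq j (x - (T x + t *\<^sub>R j ?k))
      = ennreal (g1 x * (norm (h + t *\<^sub>R ?k))\<^sup>2 + (1 - g1 x - g2 x) * (norm h)\<^sup>2
        + g2 x * (norm (h - t *\<^sub>R ?k))\<^sup>2)"
      unfolding p m h cm_norm_sq_j using g0(1,2)[of x] pos by (simp add: ennreal_mult ennreal_plus)
    moreover have "0 \<le> g1 x * (norm (h + t *\<^sub>R ?k))\<^sup>2 + (1 - g1 x - g2 x) * (norm h)\<^sup>2
        + g2 x * (norm (h - t *\<^sub>R ?k))\<^sup>2"
      using g0(1,2)[of x] pos by simp
    ultimately show ?case using le by (simp add: ennreal_leI)
  qed
  have intR: "integrable \<mu> R" unfolding R_def using intN intg by simp
  \<comment> \<open>The test function 1 shows that equal masses move in both directions, so the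
    coefficients of g1 and g2 in R add up to 2 t (t - (b - a)) < 0.\<close>
  have eq12: "(\<integral>x. g1 x \<partial>\<mu>) = (\<integral>x. g2 x \<partial>\<mu>)"
    using common[of "\<lambda>_. 1"] g0 by (simp add: integral_eq_nn_integral)
  have "ennreal (\<integral>x. N x \<partial>\<mu>) = (\<integral>\<^sup>+x. cm_norm_sq j (x - T x) \<partial>\<mu>)"
    unfolding costN using intN N0 by (subst nn_integral_eq_integral) auto
  also have "\<dots> \<le> transport_cost j \<beta>"
    using opt \<beta> unfolding mk_solution_def transport_cost_graph[OF T] by blast
  also have "\<dots> = (\<integral>\<^sup>+x. ennreal (g1 x) * cm_norm_sq j (x - (T x - t *\<^sub>R j ?k))
      + ennreal (1 - g1 x - g2 x) * cm_norm_sq j (x - T x)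
      + ennreal (g2 x) * cm_norm_sq j (x - (T x + t *\<^sub>R j ?k)) \<partial>\<mu>)"
    unfolding transport_cost_def by (subst int) auto
  also have "\<dots> \<le> (\<integral>\<^sup>+x. ennreal (R x) \<partial>\<mu>)"
    using bound by (intro nn_integral_mono_AE) (auto elim: eventually_mono)
  also have "\<dots> = ennreal (\<integral>x. R x \<partial>\<mu>)"
    using intR bound by (subst nn_integral_eq_integral) (auto elim: eventually_mono)
  finally have "(\<integral>x. N x \<partial>\<mu>) \<le> (\<integral>x. R x \<partial>\<mu>)"
    using bound by (subst (asm) ennreal_le_iff) (auto intro!: integral_nonneg_AE elim: eventually_mono)
  also have "\<dots> = (\<integral>x. N x \<partial>\<mu>) + (2 * t * (t - (b - a))) * (\<integral>x. g2 x \<partial>\<mu>)"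
    unfolding R_def using intN intg by (simp add: eq12 algebra_simps power2_eq_square)
  finally have "0 \<le> (2 * t * (t - (b - a))) * (\<integral>x. g2 x \<partial>\<mu>)" by simp
  moreover have "2 * t * (t - (b - a)) < 0" using t by (simp add: mult_pos_neg)
  ultimately have "(\<integral>x. g2 x \<partial>\<mu>) \<le> 0" by (meson mult_neg_pos not_le)
  moreover have "0 \<le> (\<integral>x. g2 x \<partial>\<mu>)" using g0 by simp
  ultimately have "(\<integral>x. g2 x \<partial>\<mu>) = 0" by simp
  then show ?thesis using intg g0 by (simp add: nn_integral_eq_integral)
qed

text \<open>On \<open>A = {f\<^sub>1 > 0, f\<^sub>2 > 0}\<close>, where \<open>f\<^sub>1, f\<^sub>2\<close> are the densities of the two images, a small
  translate of \<open>A\<close> meets \<open>A\<close>, so that the first image, translated by \<open>-t k\<close>, has a part in common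
  with the second one: swapping their targets would be profitable.\<close>

lemma images_separated:
  assumes e: "e \<in> topological_dual" and unit: "norm (riesz_vec j e) = 1"
    and T[measurable]: "T \<in> borel_measurable borel"
    and ac: "absolutely_continuous \<mu> (distr \<mu> borel T)"
    and opt: "mk_solution j \<mu> (distr \<mu> borel T) (distr \<mu> (borel \<Otimes>\<^sub>M borel) (\<lambda>x. (x, T x)))"
    and fin: "(\<integral>\<^sup>+x. cm_norm_sq j (x - T x) \<partial>\<mu>) < \<infinity>"
    and ab: "a < b"
  shows "\<exists>B\<in>sets borel. AE x in \<mu>. (e (x - T x) < a \<longrightarrow> T x \<notin> B) \<and> (b < e (x - T x) \<longrightarrow> T x \<in> B)"
proof -
  interpret \<mu>: prob_space \<mu> by (rule prob_\<mu>)
  note [measurable] = topological_dual_measurable[OF e]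
  let ?k = "j (riesz_vec j e)"
  define U1 where "U1 = {x. e (x - T x) < a}"
  define U2 where "U2 = {x. b < e (x - T x)}"
  have U[measurable]: "U1 \<in> sets borel" "U2 \<in> sets borel"
    unfolding U1_def U2_def by measurable
  define \<nu> where "\<nu> V s = distr (density \<mu> (indicator V)) borel (\<lambda>x. T x - s *\<^sub>R ?k)" for V and s :: real
  have sets_\<nu>[measurable_cong]: "sets (\<nu> V s) = sets borel" for V s by (simp add: \<nu>_def)
  have AE_\<nu>: "(AE y in \<nu> V s. P y) \<longleftrightarrow> (AE x in \<mu>. x \<in> V \<longrightarrow> P (T x - s *\<^sub>R ?k))"
    if [measurable]: "V \<in> sets borel" "Measurable.pred borel P" for V s P
    unfolding \<nu>_def
    by (subst AE_distr_iff, measurable, subst AE_density, measurable) (simp add: indicator_def)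
  have int_\<nu>: "(\<integral>\<^sup>+y. h y \<partial>\<nu> V s) = (\<integral>\<^sup>+x. indicator V x * h (T x - s *\<^sub>R ?k) \<partial>\<mu>)"
    if [measurable]: "V \<in> sets borel" "h \<in> borel_measurable borel" for V s h
    unfolding \<nu>_def by (subst nn_integral_distr, measurable, subst nn_integral_density, auto)
  have fin_\<nu>: "finite_measure (\<nu> V s)" if [measurable]: "V \<in> sets borel" for V s
  proof (rule finite_measureI)
    have "emeasure (\<nu> V s) (space (\<nu> V s)) = (\<integral>\<^sup>+y. 1 \<partial>\<nu> V s)" by simp
    also have "\<dots> = emeasure \<mu> V" by (subst int_\<nu>) (auto simp: sets_\<mu>)
    finally show "emeasure (\<nu> V s) (space (\<nu> V s)) \<noteq> \<infinity>" by (simp add: \<mu>.emeasure_eq_measure)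
  qed
  have T_AE: "AE x in \<mu>. P (T x)" if [measurable]: "Measurable.pred borel P" and "AE y in \<mu>. P y" for P
  proof -
    have "AE y in distr \<mu> borel T. P y"
      by (rule absolutely_continuous_AE[OF _ ac that(2)]) (simp add: sets_\<mu>)
    then show ?thesis by (subst (asm) AE_distr_iff) auto
  qed
  have ac_\<nu>: "absolutely_continuous \<mu> (\<nu> V s)" if [measurable]: "V \<in> sets borel" for V s
  proof (rule absolutely_continuousI_AE)
    fix A assume "A \<in> sets \<mu>" and ae: "AE x in \<mu>. x \<notin> A"
    then have [measurable]: "A \<in> sets borel" by (simp add: sets_\<mu>)
    have "AE y in \<mu>. y - s *\<^sub>R ?k \<notin> A" using AE_shift[OF e unit _ ae, of "- s"] by simp
    then have "AE x in \<mu>. T x - s *\<^sub>R ?k \<notin> A" by (intro T_AE) auto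
    then show "AE x in \<nu> V s. x \<notin> A" by (subst AE_\<nu>) auto
  qed (simp add: sets_\<mu> sets_\<nu>)
  define f where "f V s = RN_deriv \<mu> (\<nu> V s)" for V s
  have [measurable]: "f V s \<in> borel_measurable borel" for V s
    using borel_measurable_RN_deriv[of \<mu> "\<nu> V s"] unfolding f_def by (simp add: measurable_cong_sets[OF sets_\<mu> refl])
  have dens: "density \<mu> (f V s) = \<nu> V s" if "V \<in> sets borel" for V s
    unfolding f_def by (rule \<mu>.density_RN_deriv[OF ac_\<nu>[OF that]]) (simp add: sets_\<mu> sets_\<nu>)
  \<comment> \<open>Both sides say that P holds almost everywhere for \<open>\<nu> V s\<close>,
    written once as an image and once as a density.\<close>
  have AE_f: "(AE x in \<mu>. x \<in> V \<longrightarrow> P (T x - s *\<^sub>R ?k)) \<longleftrightarrow> (AE y in \<mu>. 0 < f V s y \<longrightarrow> P y)"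
    if V: "V \<in> sets borel" and [measurable]: "Measurable.pred borel P" for V s P
    unfolding AE_\<nu>[OF that, symmetric] dens[OF V, symmetric] by (subst AE_density) auto
  show ?thesis
  proof (cases "AE y in \<mu>. \<not> (0 < f U1 0 y \<and> 0 < f U2 0 y)")
    case True
    define B where "B = {y. f U1 0 y = 0}"
    have B[measurable]: "B \<in> sets borel" unfolding B_def by measurable
    have "AE y in \<mu>. 0 < f U1 0 y \<longrightarrow> y \<notin> B" by (intro AE_I2) (auto simp: B_def)
    then have "AE x in \<mu>. x \<in> U1 \<longrightarrow> T x - 0 *\<^sub>R ?k \<notin> B" by (subst AE_f) auto
    moreover have "AE y in \<mu>. 0 < f U2 0 y \<longrightarrow> y \<in> B"
      using True by eventually_elim (auto simp: B_def zero_less_iff_neq_zero)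
    then have "AE x in \<mu>. x \<in> U2 \<longrightarrow> T x - 0 *\<^sub>R ?k \<in> B" by (subst AE_f) auto
    ultimately have "AE x in \<mu>. (e (x - T x) < a \<longrightarrow> T x \<notin> B) \<and> (b < e (x - T x) \<longrightarrow> T x \<in> B)"
      by eventually_elim (auto simp: U1_def U2_def)
    then show ?thesis using B by blast
  next
    case False
    define A where "A = {y. 0 < f U1 0 y \<and> 0 < f U2 0 y}"
    have [measurable]: "A \<in> sets borel" unfolding A_def by measurable
    obtain t where t: "0 < t" "t < b - a" and meet: "\<not> (AE y in \<mu>. \<not> (y \<in> A \<and> y + t *\<^sub>R ?k \<in> A))"
      using small_translate_meets[OF e unit, of A "b - a"] False ab by (auto simp: A_def)
    \<comment> \<open>Almost every point of U1 is sent by T x - t k into the positivity set of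
      \<open>f U1 t\<close>. Read through \<open>AE_f\<close> with shift 0 and translated by t k,
      this shows that \<open>f U1 t\<close> is positive at y for almost every y at which
      \<open>f U1 0\<close> is positive at y + t k; then \<open>meet\<close> applies.\<close>
    have overlap: "\<not> (AE y in \<mu>. \<not> (0 < f U1 t y \<and> 0 < f U2 0 y))"
    proof
      assume ae: "AE y in \<mu>. \<not> (0 < f U1 t y \<and> 0 < f U2 0 y)"
      have "AE x in \<mu>. x \<in> U1 \<longrightarrow> 0 < f U1 t (T x - t *\<^sub>R ?k)"
        by (subst AE_f[of U1 "\<lambda>y. 0 < f U1 t y" t]) auto
      then have "AE x in \<mu>. x \<in> U1 \<longrightarrow> 0 < f U1 t (T x - 0 *\<^sub>R ?k - t *\<^sub>R ?k)" by simp
      then have "AE y in \<mu>. 0 < f U1 0 y \<longrightarrow> 0 < f U1 t (y - t *\<^sub>R ?k)"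
        by (subst (asm) AE_f[of U1 "\<lambda>y. 0 < f U1 t (y - t *\<^sub>R ?k)" 0]) auto
      from AE_shift[OF e unit _ this, of t]
      have "AE y in \<mu>. 0 < f U1 0 (y + t *\<^sub>R ?k) \<longrightarrow> 0 < f U1 t y" by simp
      with ae have "AE y in \<mu>. \<not> (y \<in> A \<and> y + t *\<^sub>R ?k \<in> A)"
        by eventually_elim (auto simp: A_def)
      then show False using meet by simp
    qed
    obtain w1 w2 where w: "w1 \<in> borel_measurable \<mu>" "w2 \<in> borel_measurable \<mu>"
      and w01: "\<And>y. 0 \<le> w1 y" "\<And>y. w1 y \<le> 1" "\<And>y. 0 \<le> w2 y" "\<And>y. w2 y \<le> 1"
      and wc: "\<And>h. h \<in> borel_measurable \<mu> \<Longrightarrow>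
        (\<integral>\<^sup>+y. ennreal (w1 y) * h y \<partial>\<nu> U1 t) = (\<integral>\<^sup>+y. ennreal (w2 y) * h y \<partial>\<nu> U2 0)"
      and wpos: "0 < (\<integral>\<^sup>+y. ennreal (w1 y) \<partial>\<nu> U1 t)"
    proof (rule common_part_weights)
      show "sigma_finite_measure \<mu>" by (rule \<mu>.sigma_finite_measure_axioms)
      show "finite_measure (\<nu> U1 t)" "finite_measure (\<nu> U2 0)" using U by (simp_all add: fin_\<nu>)
      show "absolutely_continuous \<mu> (\<nu> U1 t)" "absolutely_continuous \<mu> (\<nu> U2 0)"
        using U by (simp_all add: ac_\<nu>)
      show "sets (\<nu> U1 t) = sets \<mu>" "sets (\<nu> U2 0) = sets \<mu>" by (simp_all add: sets_\<nu> sets_\<mu>)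
      show "\<not> (AE y in \<mu>. \<not> (0 < RN_deriv \<mu> (\<nu> U1 t) y \<and> 0 < RN_deriv \<mu> (\<nu> U2 0) y))"
        using overlap unfolding f_def .
    qed (rule that)
    have [measurable]: "w1 \<in> borel_measurable borel" "w2 \<in> borel_measurable borel"
      using w by (simp_all add: measurable_cong_sets[OF sets_\<mu> refl])
    \<comment> \<open>The weights are pulled back along T. As a < b, the sets U1 and U2 are
      disjoint, so no point gives away more than its mass.\<close>
    define g1 where "g1 x = indicator U1 x * w1 (T x - t *\<^sub>R ?k)" for x
    define g2 where "g2 x = indicator U2 x * w2 (T x)" for x
    have [measurable]: "g1 \<in> borel_measurable borel" "g2 \<in> borel_measurable borel"
      unfolding g1_def g2_def by measurable
    have common: "(\<integral>\<^sup>+x. ennreal (g1 x) * h (T x - t *\<^sub>R ?k) \<partial>\<mu>) = (\<integral>\<^sup>+x. ennreal (g2 x) * h (T x) \<partial>\<mu>)"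
      if [measurable]: "h \<in> borel_measurable borel" for h
    proof -
      have "(\<integral>\<^sup>+x. ennreal (g1 x) * h (T x - t *\<^sub>R ?k) \<partial>\<mu>) = (\<integral>\<^sup>+y. ennreal (w1 y) * h y \<partial>\<nu> U1 t)"
        by (subst int_\<nu>) (auto intro!: nn_integral_cong simp: g1_def indicator_def)
      also have "\<dots> = (\<integral>\<^sup>+y. ennreal (w2 y) * h y \<partial>\<nu> U2 0)" by (rule wc) simp
      also have "\<dots> = (\<integral>\<^sup>+x. ennreal (g2 x) * h (T x) \<partial>\<mu>)"
        by (subst int_\<nu>) (auto intro!: nn_integral_cong simp: g2_def indicator_def)
      finally show ?thesis .
    qed
    have "(\<integral>\<^sup>+x. ennreal (g2 x) \<partial>\<mu>) = 0"
    proof (rule no_profitable_swap[OF e unit T opt fin t, of g1 g2])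
      show "g1 x + g2 x \<le> 1" for x using w01 ab by (auto simp: g1_def g2_def U1_def U2_def indicator_def)
      show "e (x - T x) < a" if "0 < g1 x" for x
        using that by (cases "e (x - T x) < a") (auto simp: g1_def U1_def indicator_def)
      show "b < e (x - T x)" if "0 < g2 x" for x
        using that by (cases "b < e (x - T x)") (auto simp: g2_def U2_def indicator_def)
    qed (use w01 common in \<open>auto simp: g1_def g2_def indicator_def\<close>)
    moreover have "(\<integral>\<^sup>+x. ennreal (g2 x) \<partial>\<mu>) = (\<integral>\<^sup>+x. ennreal (g1 x) \<partial>\<mu>)" using common[of "\<lambda>_. 1"] by simp
    moreover have "(\<integral>\<^sup>+x. ennreal (g1 x) \<partial>\<mu>) = (\<integral>\<^sup>+y. ennreal (w1 y) \<partial>\<nu> U1 t)"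
      by (subst int_\<nu>) (auto intro!: nn_integral_cong simp: g1_def indicator_def)
    ultimately show ?thesis using wpos by simp
  qed
qed

section \<open>Recovering a point from its image under the transport map\<close>

text \<open>After normalization, the separating sets for all rational a < b determine e (x - T x)
  from T x, and adding e (T x) gives e x. If the vector of e is 0, then e vanishes on the range of
  j, so already e x = e (T x).\<close>

lemma functional_determined:
  assumes e: "e \<in> topological_dual"
    and T[measurable]: "T \<in> borel_measurable borel"
    and ac: "absolutely_continuous \<mu> (distr \<mu> borel T)"
    and opt: "mk_solution j \<mu> (distr \<mu> borel T) (distr \<mu> (borel \<Otimes>\<^sub>M borel) (\<lambda>x. (x, T x)))"
    and fin: "(\<integral>\<^sup>+x. cm_norm_sq j (x - T x) \<partial>\<mu>) < \<infinity>"
  shows "\<exists>g\<in>borel_measurable borel. AE x in \<mu>. e x = g (T x)"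
proof (cases "riesz_vec j e = 0")
  case True
  have "AE x in \<mu>. cm_norm_sq j (x - T x) \<noteq> \<infinity>"
    using fin by (intro nn_integral_PInf_AE) auto
  then have "AE x in \<mu>. e x = e (T x)"
  proof eventually_elim
    case (elim x)
    then obtain h where "x - T x = j h" using cm_norm_sq_finite[of "x - T x"] by (auto simp: less_top)
    then show ?case
      using riesz_vec[OF e, of h] True linear_diff[OF topological_dual_linear[OF e], of x "T x"] by simp
  qed
  then show ?thesis using topological_dual_measurable[OF e] by blast
next
  case False
  define r where "r = norm (riesz_vec j e)"
  have r: "0 < r" using False by (simp add: r_def)
  define e1 where "e1 x = (1 / r) * e x" for x
  have e1: "e1 \<in> topological_dual"
    using topological_dual_scale[OF e, of "1 / r"] unfolding e1_def .
  have "riesz_vec j e1 = (1 / r) *\<^sub>R riesz_vec j e"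
    by (rule riesz_vec_eqI[OF e1]) (simp add: e1_def riesz_vec[OF e])
  then have unit: "norm (riesz_vec j e1) = 1" using r by (simp add: r_def)
  note [measurable] = topological_dual_measurable[OF e]
  define sep where "sep a b C \<longleftrightarrow> (AE x in \<mu>. (e1 (x - T x) < real_of_rat a \<longrightarrow> T x \<notin> C)
    \<and> (real_of_rat b < e1 (x - T x) \<longrightarrow> T x \<in> C))" for a b C
  have "\<exists>C\<in>sets borel. a < b \<longrightarrow> sep a b C" for a b
  proof (cases "a < b")
    case True
    then have "real_of_rat a < real_of_rat b" by (simp add: of_rat_less)
    from images_separated[OF e1 unit T ac opt fin this] show ?thesis unfolding sep_def by blast
  qed auto
  then obtain B where B[measurable]: "\<And>a b. B a b \<in> sets borel"
    and sep: "\<And>a b. a < b \<Longrightarrow> sep a b (B a b)"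
    by metis
  \<comment> \<open>If T x lies in \<open>B a b\<close>, then a is at most
    \<open>e1 (x - T x)\<close>; conversely T x lies in \<open>B a b\<close> whenever a < b <
    \<open>e1 (x - T x)\<close>. So the supremum is that value, and pairs without information
    contribute minus infinity.\<close>
  define G where "G y = (SUP (a, b)\<in>{(a, b). a < b}. if y \<in> B a b then ereal (real_of_rat a) else - \<infinity>)" for y
  have [measurable]: "G \<in> borel_measurable borel" unfolding G_def case_prod_beta
    by (intro borel_measurable_SUP) auto
  have "AE x in \<mu>. \<forall>a b. a < b \<longrightarrow> (e1 (x - T x) < real_of_rat a \<longrightarrow> T x \<notin> B a b) \<and>
      (real_of_rat b < e1 (x - T x) \<longrightarrow> T x \<in> B a b)"
  proof (intro AE_all_countable[THEN iffD2] allI)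
    fix a b
    show "AE x in \<mu>. a < b \<longrightarrow> (e1 (x - T x) < real_of_rat a \<longrightarrow> T x \<notin> B a b) \<and>
      (real_of_rat b < e1 (x - T x) \<longrightarrow> T x \<in> B a b)"
      using sep[of a b] by (cases "a < b") (simp_all add: sep_def)
  qed
  then have "AE x in \<mu>. e x = r * real_of_ereal (G (T x)) + e (T x)"
  proof eventually_elim
    case (elim x)
    have "G (T x) = ereal (e1 (x - T x))"
    proof (rule antisym)
      show "G (T x) \<le> ereal (e1 (x - T x))"
        unfolding G_def
      proof (intro SUP_least, clarify)
        fix a b :: rat assume "a < b"
        then have "e1 (x - T x) < real_of_rat a \<longrightarrow> T x \<notin> B a b" using elim by blast
        then show "(if T x \<in> B a b then ereal (real_of_rat a) else - \<infinity>) \<le> ereal (e1 (x - T x))"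
          by (auto simp: not_less)
      qed
      show "ereal (e1 (x - T x)) \<le> G (T x)"
      proof (rule dense_le)
        fix z assume "z < ereal (e1 (x - T x))"
        then obtain a where a: "z < ereal (real_of_rat a)" "ereal (real_of_rat a) < ereal (e1 (x - T x))"
          using ereal_dense3 by blast
        then obtain b where b: "ereal (real_of_rat a) < ereal (real_of_rat b)" "ereal (real_of_rat b) < ereal (e1 (x - T x))"
          using ereal_dense3 by blast
        then have "a < b" "T x \<in> B a b" using elim by (auto simp: of_rat_less)
        then have "ereal (real_of_rat a) \<le> G (T x)" unfolding G_def
          by (intro SUP_upper2[of "(a, b)"]) auto
        then show "z \<le> G (T x)" using a by simp
      qed
    qed
    then show ?case using r linear_diff[OF topological_dual_linear[OF e], of x "T x"] by (simp add: e1_def)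
  qed
  moreover have "(\<lambda>y. r * real_of_ereal (G y) + e y) \<in> borel_measurable borel" by measurable
  ultimately show ?thesis by (intro bexI[of _ "\<lambda>y. r * real_of_ereal (G y) + e y"]) auto
qed

lemma transport_left_inverse:
  assumes T[measurable]: "T \<in> borel_measurable borel"
    and ac: "absolutely_continuous \<mu> (distr \<mu> borel T)"
    and opt: "mk_solution j \<mu> (distr \<mu> borel T) (distr \<mu> (borel \<Otimes>\<^sub>M borel) (\<lambda>x. (x, T x)))"
    and fin: "(\<integral>\<^sup>+x. cm_norm_sq j (x - T x) \<partial>\<mu>) < \<infinity>"
  shows "\<exists>S\<in>borel_measurable borel. AE x in \<mu>. S (T x) = x"
proof -
  obtain e D where "norming_family (e :: nat \<Rightarrow> nat \<Rightarrow> 'w \<Rightarrow> real) D" using norming_family_exists by blast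
  then interpret norming_family e D .
  obtain g where g[measurable]: "\<And>i n. g i n \<in> borel_measurable borel"
    and eq: "\<And>i n. AE x in \<mu>. e i n x = g i n (T x)"
    using functional_determined[OF dual T ac opt fin] by metis
  \<comment> \<open>The quantifiers of \<open>complete\<close> range over countable sets, so Y is
    Borel, and almost every T x lies in Y by \<open>dense\<close>. Off Y the coordinates of S are
    those of the vector 0.\<close>
  define Y where "Y = {y. \<forall>m. \<exists>l. \<forall>i\<le>m. \<forall>n. \<bar>g i n y - e i n (D l)\<bar> \<le> 1 / real (Suc m)}"
  have [measurable]: "Y \<in> sets borel" unfolding Y_def by measurable
  have "\<exists>w. \<forall>i n. e i n w = (if y \<in> Y then g i n y else 0)" for y
  proof (cases "y \<in> Y")
    case True
    then show ?thesis using complete[of "\<lambda>i n. g i n y"] by (simp add: Y_def)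
  next
    case False
    then show ?thesis by (intro exI[of _ 0]) (simp add: linear_0[OF linear_e])
  qed
  then obtain S where S: "\<And>y i n. e i n (S y) = (if y \<in> Y then g i n y else 0)" by metis
  have "S \<in> borel_measurable borel" by (rule measurable_coordinatesI) (simp add: S)
  moreover have "AE x in \<mu>. \<forall>i n. e i n x = g i n (T x)" using eq by (simp add: AE_all_countable)
  then have "AE x in \<mu>. S (T x) = x"
  proof eventually_elim
    case (elim x)
    have "T x \<in> Y" using dense[of x] elim by (simp add: Y_def dual_nbhd_def)
    then show ?case using elim by (intro separating) (simp add: S)
  qed
  ultimately show ?thesis by blast
qed

section \<open>Construction of the rotation\<close>

text \<open>Swapping the two components of a coupling preserves the cost. This connects the
  assumption on the distance from Z\<mu> to \<mu> with couplings whose first marginal is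
  \<mu>.\<close>

lemma dH_sq_commute_le: "dH_sq j \<xi> \<eta> \<le> dH_sq j \<eta> \<xi>"
  unfolding dH_sq_def
proof (rule INF_greatest)
  fix \<beta> assume \<beta>: "\<beta> \<in> couplings \<eta> \<xi>"
  let ?s = "\<lambda>z::'w \<times> 'w. (snd z, fst z)"
  have sets[measurable_cong]: "sets \<beta> = sets (borel \<Otimes>\<^sub>M borel)" using \<beta> by (simp add: couplings_def)
  interpret \<beta>: prob_space \<beta> using \<beta> by (simp add: couplings_def)
  have "distr \<beta> (borel \<Otimes>\<^sub>M borel) ?s \<in> couplings \<xi> \<eta>"
    using \<beta> by (auto simp: couplings_def distr_distr o_def intro!: \<beta>.prob_space_distr)
  moreover have "transport_cost j (distr \<beta> (borel \<Otimes>\<^sub>M borel) ?s) = transport_cost j \<beta>"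
  proof -
    have "transport_cost j (distr \<beta> (borel \<Otimes>\<^sub>M borel) ?s) = (\<integral>\<^sup>+z. cm_norm_sq j (- (fst z - snd z)) \<partial>\<beta>)"
      unfolding transport_cost_def by (subst nn_integral_distr) auto
    also have "\<dots> = transport_cost j \<beta>"
      unfolding cm_norm_sq_minus transport_cost_def by (simp add: case_prod_unfold)
    finally show ?thesis .
  qed
  ultimately show "(INF \<beta>\<in>couplings \<xi> \<eta>. transport_cost j \<beta>) \<le> transport_cost j \<beta>"
    by (intro INF_lower2[of "distr \<beta> (borel \<Otimes>\<^sub>M borel) ?s"]) simp_all
qed

end

theorem theorem6p8:
  fixes j :: "'h::{real_inner, polish_space} \<Rightarrow> 'w::{frechet_space, second_countable_topology}"
    and \<mu> :: "'w measure"
    and Z T :: "'w \<Rightarrow> 'w"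
  assumes "abstract_wiener_space j \<mu>"
    and "Z \<in> borel_measurable borel"
    and "absolutely_continuous \<mu> (distr \<mu> borel Z)"
    and "dH_sq j (distr \<mu> borel Z) \<mu> < \<infinity>"
    and "transport_map j \<mu> (distr \<mu> borel Z) T"
  shows "\<exists>s \<in> borel_measurable borel. distr \<mu> borel s = \<mu> \<and> (AE x in \<mu>. Z x = T (s x))"
proof -
  interpret abstract_wiener_space j \<mu> by fact
  note Z[measurable] = assms(2)
  let ?\<gamma> = "distr \<mu> (borel \<Otimes>\<^sub>M borel) (\<lambda>x. (x, T x))"
  have T[measurable]: "T \<in> borel_measurable borel" and opt: "mk_solution j \<mu> (distr \<mu> borel Z) ?\<gamma>"
    using assms(5) by (auto simp: transport_map_def)
  have "distr ?\<gamma> borel snd = distr \<mu> borel Z" using opt by (simp add: mk_solution_def couplings_def)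
  then have TZ: "distr \<mu> borel T = distr \<mu> borel Z" by (simp add: distr_distr o_def)
  have "transport_cost j ?\<gamma> \<le> dH_sq j \<mu> (distr \<mu> borel Z)"
    using opt unfolding mk_solution_def dH_sq_def by (intro INF_greatest) auto
  also have "\<dots> < \<infinity>" using dH_sq_commute_le assms(4) by (rule order.strict_trans1)
  finally have fin: "(\<integral>\<^sup>+x. cm_norm_sq j (x - T x) \<partial>\<mu>) < \<infinity>" by (simp add: transport_cost_graph)
  obtain S where S[measurable]: "S \<in> borel_measurable borel" and ST: "AE x in \<mu>. S (T x) = x"
    using transport_left_inverse[OF T _ _ fin] assms(3) opt unfolding TZ by blast
  have "distr \<mu> borel (\<lambda>x. S (Z x)) = distr (distr \<mu> borel T) borel S"
    unfolding TZ by (subst distr_distr) (auto simp: o_def)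
  also have "\<dots> = distr \<mu> borel (\<lambda>x. x)"
    using ST by (subst distr_distr) (auto simp: o_def intro!: distr_cong_AE)
  also have "\<dots> = \<mu>" by (rule distr_id2) (simp add: sets_\<mu>)
  finally have rotation: "distr \<mu> borel (\<lambda>x. S (Z x)) = \<mu>" .
  \<comment> \<open>T (S y) = y holds almost surely at y = T x; being a Borel condition on y, it
    depends only on the law of T and hence holds at y = Z x as well.\<close>
  have TS[measurable]: "Measurable.pred borel (\<lambda>y. T (S y) = y)" by (rule frechet_pred_eq) auto
  have "AE x in \<mu>. T (S (T x)) = T x" using ST by eventually_elim simp
  then have "AE y in distr \<mu> borel Z. T (S y) = y"
    unfolding TZ[symmetric] by (subst AE_distr_iff) auto
  then have "AE x in \<mu>. T (S (Z x)) = Z x" by (subst (asm) AE_distr_iff) auto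
  then have "AE x in \<mu>. Z x = T (S (Z x))" by eventually_elim simp
  then show ?thesis using rotation by (intro bexI[of _ "\<lambda>x. S (Z x)"]) auto
qed

end
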